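(* Let $M=(E,\mathcal{F})$ be a matroid and $k$ a field of characteristic zero. The algebra $Q/J_M$ is Gorenstein if and only if the lattice of flats $L(M)$ is a modular geometric lattice.
   Context: A matroid $M=(E,\mathcal{F})$ is a finite set $E$ with its system $\mathcal{F}\subset 2^E$ of independent sets; $r(S)=\max\{\#F: F\in\mathcal{F},F\subset S\}$ is the rank function, $\sigma(S)=\{y\in E: r(S\cup\{y\})=r(S)\}$ is the closure, and $S\sim T$ means $\sigma(S)=\sigma(T)$. A flat is a subset $S$ with $S=\sigma(S)$; $L(M)$ is the lattice of flats ordered by inclusion, graded by $r$. Let $k$ be a field of characteristic zero, $Q=k[X_e\mid e\in E]$, $X_S=\prod_{e\in S}X_e$ for $S\subset E$, and let $J_M\subset Q$ be the ideal generated by $$\Lambda_M=\{X_e^2\mid e\in E\}\cup\{X_S\mid S\subset E,\ S\notin\mathcal{F}\}\cup\{X_A-X_{A'}\mid A,A'\in\mathcal{F},A\sim A'\}.$$ $Q/J_M$ is a finite-dimensional graded $k$-algebra. A finite graded lattice $L$ with rank function $r$ is (upper) semimodular if $r(x)+r(y)\ge r(x\wedge y)+r(x\vee y)$ for all $x,y\in L$, and modular if equality holds for all $x,y$. It is atomic if every element is a join of atoms (elements covering the minimum $\hat0$), and geometric if it is atomic and semimodular. *)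

theory Defs
  imports "HOL-Algebra.QuotRing" "HOL-Algebra.Lattice" "HOL-Library.Poly_Mapping"
begin

section \<open>Matroids\<close>

locale matroid =
  fixes E :: "'e set" and \<F> :: "'e set set"
  assumes finite_ground: "finite E"
    and indep_subset: "F \<in> \<F> \<Longrightarrow> F \<subseteq> E"
    and indep_empty: "{} \<in> \<F>"
    and indep_mono: "F \<in> \<F> \<Longrightarrow> G \<subseteq> F \<Longrightarrow> G \<in> \<F>"
    and indep_augment: "F \<in> \<F> \<Longrightarrow> G \<in> \<F> \<Longrightarrow> card F < card G
          \<Longrightarrow> \<exists>e \<in> G - F. insert e F \<in> \<F>"

definition rank :: "'e set set \<Rightarrow> 'e set \<Rightarrow> nat" where
  "rank \<F> S = Max {card F | F. F \<in> \<F> \<and> F \<subseteq> S}"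

definition clos :: "'e set \<Rightarrow> 'e set set \<Rightarrow> 'e set \<Rightarrow> 'e set" where
  "clos E \<F> S = {y \<in> E. rank \<F> (S \<union> {y}) = rank \<F> S}"

definition flats :: "'e set \<Rightarrow> 'e set set \<Rightarrow> 'e set set" where
  "flats E \<F> = {S. S \<subseteq> E \<and> S = clos E \<F> S}"

definition flat_lattice :: "'e set \<Rightarrow> 'e set set \<Rightarrow> 'e set gorder" where
  "flat_lattice E \<F> = \<lparr>carrier = flats E \<F>, eq = (=), le = (\<subseteq>)\<rparr>"


section \<open>Finite graded lattices\<close>

definition covers :: "'a gorder \<Rightarrow> 'a \<Rightarrow> 'a \<Rightarrow> bool" where
  "covers L y x \<longleftrightarrow> x \<in> carrier L \<and> y \<in> carrier L \<and> x \<sqsubset>\<^bsub>L\<^esub> y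
     \<and> \<not> (\<exists>z \<in> carrier L. x \<sqsubset>\<^bsub>L\<^esub> z \<and> z \<sqsubset>\<^bsub>L\<^esub> y)"

definition finite_graded_lattice :: "'a gorder \<Rightarrow> ('a \<Rightarrow> nat) \<Rightarrow> bool" where
  "finite_graded_lattice L r \<longleftrightarrow> lattice L \<and> finite (carrier L) \<and> carrier L \<noteq> {}
     \<and> r \<bottom>\<^bsub>L\<^esub> = 0 \<and> (\<forall>x y. covers L y x \<longrightarrow> r y = r x + 1)"

definition semimodular :: "'a gorder \<Rightarrow> ('a \<Rightarrow> nat) \<Rightarrow> bool" where
  "semimodular L r \<longleftrightarrow>
     (\<forall>x \<in> carrier L. \<forall>y \<in> carrier L. r x + r y \<ge> r (x \<sqinter>\<^bsub>L\<^esub> y) + r (x \<squnion>\<^bsub>L\<^esub> y))"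

definition modular :: "'a gorder \<Rightarrow> ('a \<Rightarrow> nat) \<Rightarrow> bool" where
  "modular L r \<longleftrightarrow>
     (\<forall>x \<in> carrier L. \<forall>y \<in> carrier L. r x + r y = r (x \<sqinter>\<^bsub>L\<^esub> y) + r (x \<squnion>\<^bsub>L\<^esub> y))"

definition atoms :: "'a gorder \<Rightarrow> 'a set" where
  "atoms L = {a. covers L a \<bottom>\<^bsub>L\<^esub>}"

text \<open>The minimum is the join of the empty set of atoms.\<close>

definition atomic :: "'a gorder \<Rightarrow> bool" where
  "atomic L \<longleftrightarrow> (\<forall>x \<in> carrier L. \<exists>A \<subseteq> atoms L. is_lub L x A)"

definition geometric_lattice :: "'a gorder \<Rightarrow> ('a \<Rightarrow> nat) \<Rightarrow> bool" where
  "geometric_lattice L r \<longleftrightarrow> finite_graded_lattice L r \<and> atomic L \<and> semimodular L r"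

definition modular_geometric_lattice :: "'a gorder \<Rightarrow> ('a \<Rightarrow> nat) \<Rightarrow> bool" where
  "modular_geometric_lattice L r \<longleftrightarrow> geometric_lattice L r \<and> modular L r"


section \<open>The algebra of a matroid\<close>

text \<open>A monomial is a finitely supported exponent vector and a polynomial a finitely
  supported coefficient function on monomials.  The polynomial ring on \<^term>\<open>E\<close> is the
  subring of those polynomials in which only variables from \<^term>\<open>E\<close> occur.\<close>

type_synonym ('e, 'k) mpoly = "('e \<Rightarrow>\<^sub>0 nat) \<Rightarrow>\<^sub>0 'k"

definition mpoly_ring :: "'e set \<Rightarrow> ('e, 'k :: comm_ring_1) mpoly ring" where
  "mpoly_ring E = \<lparr>carrier = {p. \<forall>m \<in> Poly_Mapping.keys p. Poly_Mapping.keys m \<subseteq> E},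
     mult = (*), one = 1, zero = 0, add = (+)\<rparr>"

definition X_var :: "'e \<Rightarrow> ('e, 'k :: comm_ring_1) mpoly" where
  "X_var e = Poly_Mapping.single (Poly_Mapping.single e 1) 1"

definition X_set :: "'e set \<Rightarrow> ('e, 'k :: comm_ring_1) mpoly" where
  "X_set S = (\<Prod>e \<in> S. X_var e)"

definition Lambda :: "'e set \<Rightarrow> 'e set set \<Rightarrow> ('e, 'k :: comm_ring_1) mpoly set" where
  "Lambda E \<F> = {X_var e ^ 2 | e. e \<in> E} \<union> {X_set S | S. S \<subseteq> E \<and> S \<notin> \<F>}
     \<union> {X_set A - X_set A' | A A'. A \<in> \<F> \<and> A' \<in> \<F> \<and> clos E \<F> A = clos E \<F> A'}"

definition matroid_ideal :: "'e set \<Rightarrow> 'e set set \<Rightarrow> ('e, 'k :: comm_ring_1) mpoly set" where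
  "matroid_ideal E \<F> = Idl\<^bsub>mpoly_ring E\<^esub> (Lambda E \<F>)"


section \<open>Artinian Gorenstein rings\<close>

definition artinian :: "('a, 'b) ring_scheme \<Rightarrow> bool" where
  "artinian R \<longleftrightarrow> (\<forall>I :: nat \<Rightarrow> 'a set.
     (\<forall>n. ideal (I n) R \<and> I (Suc n) \<subseteq> I n) \<longrightarrow> (\<exists>n. \<forall>j \<ge> n. I j = I n))"

definition local_with :: "('a, 'b) ring_scheme \<Rightarrow> 'a set \<Rightarrow> bool" where
  "local_with R \<mm> \<longleftrightarrow> maximalideal \<mm> R \<and> (\<forall>\<nn>. maximalideal \<nn> R \<longrightarrow> \<nn> = \<mm>)"

definition socle :: "('a, 'b) ring_scheme \<Rightarrow> 'a set \<Rightarrow> 'a set" where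
  "socle R \<mm> = {x \<in> carrier R. \<forall>a \<in> \<mm>. a \<otimes>\<^bsub>R\<^esub> x = \<zero>\<^bsub>R\<^esub>}"

text \<open>An Artinian local ring \<open>(R, \<mm>)\<close> is Gorenstein if its socle \<open>(0 : \<mm>)\<close> is a
  one-dimensional vector space over the residue field \<open>R / \<mm>\<close>.  As \<open>\<mm>\<close> annihilates the
  socle, the \<open>R / \<mm>\<close>-multiples of a socle element \<open>s\<close> are its \<open>R\<close>-multiples, and
  one-dimensionality says that some nonzero \<open>s\<close> spans.\<close>

definition artinian_gorenstein :: "('a, 'b) ring_scheme \<Rightarrow> bool" where
  "artinian_gorenstein R \<longleftrightarrow> cring R \<and> artinian R \<and> (\<exists>\<mm>. local_with R \<mm> \<and>
     (\<exists>s \<in> socle R \<mm>. s \<noteq> \<zero>\<^bsub>R\<^esub> \<and> socle R \<mm> = {a \<otimes>\<^bsub>R\<^esub> s | a. a \<in> carrier R}))"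

end

theory Submission
  imports Defs
begin

text \<open>
  The classes \<open>y\<^sub>F\<close> of the monomials of bases of the flats \<open>F\<close> form a basis of \<open>Q/J\<close>, and
  \<open>X\<^sub>e y\<^sub>F = y\<^bsub>\<sigma>(F \<union> e)\<^esub>\<close> if \<open>e \<notin> F\<close>, while \<open>X\<^sub>e y\<^sub>F = 0\<close> if \<open>e \<in> F\<close>.  The algebra is therefore
  Gorenstein iff no functions on flats other than the multiples of \<open>y\<^sub>E\<close> are killed by all \<open>X\<^sub>e\<close>.

  If \<open>L(M)\<close> is modular and \<open>c\<close> is killed by all \<open>X\<^sub>e\<close>, fix a flat \<open>G\<close> and sum \<open>c\<close> over the flats covered
  by \<open>G\<close> that contain a flat \<open>z \<subseteq> G\<close>.  A flat \<open>z\<close> of rank at least 2 meets every flat \<open>H\<close> covered by \<open>G\<close>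
  that does not contain \<open>z\<close> in a flat covered by \<open>z\<close>, so double counting shows that the sum is
  independent of \<open>z\<close>.  It is 0 for \<open>z = G\<close> and \<open>c F\<close> for \<open>z = F\<close> covered by \<open>G\<close>.

  Conversely, a trivial socle makes the multiplication pairing nondegenerate.  For a hyperplane
  \<open>H\<close> this yields \<open>a : E \<rightarrow> k\<close> whose sum over the complement of a hyperplane \<open>K\<close> is 1 if \<open>K = H\<close> and 0
  otherwise, and for a line \<open>l\<close> through a point \<open>p\<close> weights \<open>c\<close> on the hyperplanes through \<open>p\<close> whose sum
  over those avoiding \<open>q\<close> is 1 if \<open>q \<in> l - p\<close> and 0 otherwise.  For \<open>p \<notin> H\<close>, pairing the two shows that
  \<open>a\<close> has the same mass on \<open>p\<close> and on \<open>l\<close>, hence the same mass \<open>\<beta>\<close> on all points outside \<open>H\<close>.  A line missing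
  \<open>H\<close> would force \<open>\<beta> = m \<beta>\<close> with \<open>m \<ge> 2\<close>, so \<open>\<beta> = 0\<close>, but \<open>a\<close> has total mass 1 outside \<open>H\<close>.  So every line
  meets every hyperplane, which is equivalent to modularity.
\<close>

section \<open>Rank, closure and flats\<close>

context matroid
begin

abbreviation r where "r \<equiv> rank \<F>"
abbreviation cl where "cl \<equiv> clos E \<F>"
abbreviation Fl where "Fl \<equiv> flats E \<F>"

section \<open>Rank: bases and submodularity\<close>

lemma finite_indep: "finite \<F>"
  using finite_subset[of \<F> "Pow E"] indep_subset finite_ground by auto

lemma indep_finite: "A \<in> \<F> \<Longrightarrow> finite A"
  using indep_subset finite_ground finite_subset by blast

lemma finite_cards: "finite {card F | F. F \<in> \<F> \<and> F \<subseteq> S}"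
  using finite_indep by auto

lemma card_le_rank: "A \<in> \<F> \<Longrightarrow> A \<subseteq> S \<Longrightarrow> card A \<le> r S"
  unfolding rank_def by (rule Max_ge[OF finite_cards]) auto

lemma ex_basis: "\<exists>B\<in>\<F>. B \<subseteq> S \<and> card B = r S"
proof -
  have "{card F | F. F \<in> \<F> \<and> F \<subseteq> S} \<noteq> {}" using indep_empty by auto
  from Max_in[OF finite_cards this] show ?thesis unfolding rank_def by auto
qed

lemma rank_leI: "(\<And>A. A \<in> \<F> \<Longrightarrow> A \<subseteq> S \<Longrightarrow> card A \<le> n) \<Longrightarrow> r S \<le> n"
  using ex_basis by metis

lemma rank_mono: "S \<subseteq> T \<Longrightarrow> r S \<le> r T"
  by (rule rank_leI) (auto intro: card_le_rank)

lemma rank_le_card: "finite S \<Longrightarrow> r S \<le> card S"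
  by (rule rank_leI) (auto intro: card_mono)

lemma rank_indep: "A \<in> \<F> \<Longrightarrow> r A = card A"
  using rank_le_card[OF indep_finite] card_le_rank[of A A] by fastforce

lemma rank_empty [simp]: "r {} = 0"
  using rank_indep[OF indep_empty] by simp

lemma indep_iff_rank: "A \<subseteq> E \<Longrightarrow> A \<in> \<F> \<longleftrightarrow> r A = card A"
  by (metis card_subset_eq ex_basis finite_ground finite_subset rank_indep)

text \<open>A largest independent set between \<open>I\<close> and \<open>S\<close> has
  \<open>r S\<close> elements, since otherwise augmentation from a basis of \<open>S\<close> would
  enlarge it inside \<open>S\<close>.\<close>

lemma extend_basis:
  assumes "I \<in> \<F>" "I \<subseteq> S"
  obtains B where "B \<in> \<F>" "I \<subseteq> B" "B \<subseteq> S" "card B = r S"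
proof -
  let ?P = "\<lambda>B. B \<in> \<F> \<and> I \<subseteq> B \<and> B \<subseteq> S"
  have "\<exists>B. ?P B \<and> (\<forall>C. ?P C \<longrightarrow> card C \<le> card B)"
    by (rule ex_has_greatest_nat[where b = "r S + 1" and k = I])
      (use assms card_le_rank in \<open>auto simp: less_Suc_eq_le\<close>)
  then obtain B where B: "?P B" "\<And>C. ?P C \<Longrightarrow> card C \<le> card B" by blast
  have "\<not> card B < r S"
  proof
    assume "card B < r S"
    moreover obtain D where D: "D \<in> \<F>" "D \<subseteq> S" "card D = r S" using ex_basis by blast
    ultimately obtain e where e: "e \<in> D - B" "insert e B \<in> \<F>"
      using indep_augment[of B D] B(1) by auto
    then have "card (insert e B) \<le> card B" using B D by blast
    then show False using e indep_finite[of B] B(1) by auto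
  qed
  then have "card B = r S" using card_le_rank[of B S] B(1) by auto
  then show thesis using that B(1) by blast
qed

text \<open>A basis of \<open>A \<inter> B\<close> extends to a basis \<open>K\<close> of
  \<open>A \<union> B\<close>. The traces of \<open>K\<close> on \<open>A\<close> and on
  \<open>B\<close> are independent, and their sizes add up to at least the left-hand side.\<close>

lemma rank_submod: "r (A \<union> B) + r (A \<inter> B) \<le> r A + r B"
proof -
  obtain I where I: "I \<in> \<F>" "I \<subseteq> A \<inter> B" "card I = r (A \<inter> B)" using ex_basis by blast
  obtain K where K: "K \<in> \<F>" "I \<subseteq> K" "K \<subseteq> A \<union> B" "card K = r (A \<union> B)"
    using extend_basis[of I "A \<union> B"] I by blast
  have fin: "finite K" using K indep_finite by blast
  have "card (K \<inter> A) + card (K \<inter> B) = card (K \<inter> A \<union> K \<inter> B) + card (K \<inter> A \<inter> (K \<inter> B))"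
    using fin by (intro card_Un_Int) auto
  moreover have "card (K \<inter> A \<union> K \<inter> B) = card K" using K by (intro arg_cong[of _ _ card]) blast
  moreover have "card I \<le> card (K \<inter> A \<inter> (K \<inter> B))" using fin K I by (intro card_mono) auto
  moreover have "card (K \<inter> A) \<le> r A" "card (K \<inter> B) \<le> r B"
    using K(1) indep_mono by (auto intro!: card_le_rank)
  ultimately show ?thesis using I(3) K(4) by linarith
qed

lemma rank_insert_le: "r (insert e S) \<le> r S + 1"
  using rank_submod[of "{e}" S] rank_le_card[of "{e}"] by simp

lemma rank_Un_le: "finite Z \<Longrightarrow> r (S \<union> Z) \<le> r S + card Z"
  using rank_submod[of S Z] rank_le_card[of Z] by linarith

section \<open>Closure\<close>

lemma clos_subset: "cl S \<subseteq> E"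
  by (auto simp: clos_def)

lemma subset_clos: "S \<subseteq> E \<Longrightarrow> S \<subseteq> cl S"
  by (auto simp: clos_def insert_absorb)

lemma in_clos_iff: "y \<in> cl S \<longleftrightarrow> y \<in> E \<and> r (insert y S) = r S"
  by (simp add: clos_def)

lemma in_clos_iff_le: "y \<in> cl S \<longleftrightarrow> y \<in> E \<and> r (insert y S) \<le> r S"
  using rank_mono[OF subset_insertI[of S y]] by (auto simp: in_clos_iff)

lemma not_in_closD: "y \<in> E \<Longrightarrow> y \<notin> cl S \<Longrightarrow> r (insert y S) = r S + 1"
  using rank_insert_le[of y S] rank_mono[of S "insert y S"] by (force simp: in_clos_iff)

lemma clos_mono:
  assumes "S \<subseteq> T"
  shows "cl S \<subseteq> cl T"
proof
  fix y assume y: "y \<in> cl S"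
  have "r (insert y S \<union> T) + r (insert y S \<inter> T) \<le> r (insert y S) + r T" by (rule rank_submod)
  moreover have "insert y S \<union> T = insert y T" using assms by blast
  moreover have "r S \<le> r (insert y S \<inter> T)" using assms by (intro rank_mono) blast
  ultimately have "r (insert y T) \<le> r T" using y by (simp add: in_clos_iff)
  then show "y \<in> cl T" using y by (simp add: in_clos_iff_le)
qed

text \<open>Elements are adjoined one at a time; by monotonicity each still lies in the closure of
  the set built so far and leaves the rank unchanged.\<close>

lemma rank_Un_clos: "X \<subseteq> cl S \<Longrightarrow> r (S \<union> X) = r S"
proof -
  assume X: "X \<subseteq> cl S"
  have "finite X" using X clos_subset finite_ground finite_subset by metis
  then show ?thesis using X
  proof (induction X rule: finite_induct)
    case (insert x X)
    have "x \<in> cl (S \<union> X)" using insert.prems clos_mono[of S "S \<union> X"] by auto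
    then show ?case using insert by (simp add: in_clos_iff)
  qed auto
qed

lemma rank_clos: "S \<subseteq> E \<Longrightarrow> r (cl S) = r S"
  using rank_Un_clos[of "cl S" S] subset_clos[of S] by (simp add: Un_absorb1)

lemma clos_clos: "S \<subseteq> E \<Longrightarrow> cl (cl S) = cl S"
proof -
  assume S: "S \<subseteq> E"
  have "y \<in> cl S" if "y \<in> cl (cl S)" for y
  proof -
    have "r (insert y S) \<le> r (insert y (cl S))" using subset_clos[OF S] by (intro rank_mono) auto
    also have "\<dots> = r S" using that rank_clos[OF S] by (simp add: in_clos_iff)
    finally show ?thesis using that by (simp add: in_clos_iff_le)
  qed
  then show ?thesis using subset_clos[of "cl S"] clos_subset by auto
qed

text \<open>Adjoining an element of \<open>T\<close> to \<open>S\<close> stays inside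
  \<open>T\<close> and cannot raise the rank, so \<open>T\<close> lies in
  \<open>cl S\<close>.\<close>

lemma clos_eqI:
  assumes "S \<subseteq> T" "T \<subseteq> E" "r T \<le> r S"
  shows "cl S = cl T"
proof -
  have "T \<subseteq> cl S"
  proof
    fix y assume "y \<in> T"
    then have "r (insert y S) \<le> r T" using assms by (intro rank_mono) auto
    then show "y \<in> cl S" using assms \<open>y \<in> T\<close> by (auto simp: in_clos_iff_le)
  qed
  then have "cl T \<subseteq> cl S" using clos_mono[of T "cl S"] clos_clos[of S] assms by auto
  then show ?thesis using clos_mono[OF assms(1)] by auto
qed

section \<open>Flats and the independent sets spanning them\<close>

lemma flats_subset: "F \<in> Fl \<Longrightarrow> F \<subseteq> E"
  by (auto simp: flats_def)

lemma flatI: "S \<subseteq> E \<Longrightarrow> cl S \<subseteq> S \<Longrightarrow> S \<in> Fl"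
  using subset_clos[of S] unfolding flats_def by blast

lemma clos_flat: "F \<in> Fl \<Longrightarrow> cl F = F"
  by (auto simp: flats_def)

lemma clos_in_flats: "S \<subseteq> E \<Longrightarrow> cl S \<in> Fl"
  using clos_clos clos_subset by (auto simp: flats_def)

lemma finite_flats: "finite Fl"
  using finite_subset[of Fl "Pow E"] finite_ground by (auto simp: flats_def)

lemma ground_flat: "E \<in> Fl"
  using subset_clos[of E] clos_subset[of E] by (auto simp: flats_def)

lemma clos_subset_flat: "S \<subseteq> F \<Longrightarrow> F \<in> Fl \<Longrightarrow> cl S \<subseteq> F"
  using clos_mono clos_flat by blast

lemma clos_subset_flat_iff: "S \<subseteq> E \<Longrightarrow> F \<in> Fl \<Longrightarrow> cl S \<subseteq> F \<longleftrightarrow> S \<subseteq> F"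
  using clos_subset_flat subset_clos by blast

lemma Int_flat:
  assumes "F \<in> Fl" "G \<in> Fl"
  shows "F \<inter> G \<in> Fl"
proof -
  have "cl (F \<inter> G) \<subseteq> F \<inter> G" using clos_subset_flat[of "F \<inter> G"] assms by simp
  moreover have "F \<inter> G \<subseteq> E" using flats_subset assms by blast
  ultimately show ?thesis by (rule flatI[rotated])
qed

lemma flat_eqI: "F \<in> Fl \<Longrightarrow> G \<in> Fl \<Longrightarrow> F \<subseteq> G \<Longrightarrow> r G \<le> r F \<Longrightarrow> F = G"
  using clos_eqI[of F G] clos_flat flats_subset by metis

lemma flat_rank_less: "F \<in> Fl \<Longrightarrow> G \<in> Fl \<Longrightarrow> F \<subset> G \<Longrightarrow> r F < r G"
  using flat_eqI[of F G] by force

lemma flat_insert_rank: "F \<in> Fl \<Longrightarrow> e \<in> E \<Longrightarrow> e \<notin> F \<Longrightarrow> r (insert e F) = r F + 1"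
  using not_in_closD clos_flat by metis

lemma clos_Un_clos:
  assumes "S \<subseteq> E" "T \<subseteq> E"
  shows "cl (cl S \<union> T) = cl (S \<union> T)"
proof
  show "cl (S \<union> T) \<subseteq> cl (cl S \<union> T)" using subset_clos[OF assms(1)] by (intro clos_mono) auto
  have "cl S \<union> T \<subseteq> cl (S \<union> T)"
    using clos_mono[of S "S \<union> T"] subset_clos[of "S \<union> T"] assms by auto
  then show "cl (cl S \<union> T) \<subseteq> cl (S \<union> T)"
    using clos_subset_flat[of _ "cl (S \<union> T)"] clos_in_flats[of "S \<union> T"] assms by simp
qed

lemma clos_insert_clos: "S \<subseteq> E \<Longrightarrow> e \<in> E \<Longrightarrow> cl (insert e (cl S)) = cl (insert e S)"
  using clos_Un_clos[of S "{e}"] by simp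

lemma indep_insert_iff:
  assumes "A \<in> \<F>" "e \<in> E" "e \<notin> A"
  shows "insert e A \<in> \<F> \<longleftrightarrow> e \<notin> cl A"
proof -
  have "insert e A \<in> \<F> \<longleftrightarrow> r (insert e A) = card A + 1"
    using indep_iff_rank[of "insert e A"] assms indep_subset[of A] indep_finite[of A] by auto
  also have "\<dots> \<longleftrightarrow> e \<notin> cl A"
    using assms not_in_closD[of e A] rank_indep[of A] by (auto simp: in_clos_iff)
  finally show ?thesis .
qed

text \<open>Makes removal of \<open>e\<close> a bijection from the independent sets containing
  \<open>e\<close> to those whose closure misses \<open>e\<close>; multiplication by
  \<open>X_var e\<close> is later computed along it.\<close>

lemma indep_insert_clos_iff:
  assumes "e \<in> E"
  shows "A \<in> \<F> \<and> e \<notin> cl A \<longleftrightarrow> insert e A \<in> \<F> \<and> e \<notin> A"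
proof
  assume *: "A \<in> \<F> \<and> e \<notin> cl A"
  then have "e \<notin> A" using subset_clos indep_subset by blast
  then show "insert e A \<in> \<F> \<and> e \<notin> A" using * indep_insert_iff assms by blast
next
  assume *: "insert e A \<in> \<F> \<and> e \<notin> A"
  then have "A \<in> \<F>" using indep_mono by blast
  then show "A \<in> \<F> \<and> e \<notin> cl A" using * indep_insert_iff assms by blast
qed

lemma flat_basis: "F \<in> Fl \<Longrightarrow> \<exists>B\<in>\<F>. cl B = F"
proof -
  assume F: "F \<in> Fl"
  obtain B where B: "B \<in> \<F>" "B \<subseteq> F" "card B = r F" using ex_basis by blast
  then have "cl B = cl F" using clos_eqI[of B F] rank_indep flats_subset[OF F] by simp
  then show ?thesis using B clos_flat[OF F] by auto
qed

end

section \<open>Modularity makes the socle trivial\<close>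

lemma linear_combination_of_functionals:
  fixes A :: "'i \<Rightarrow> 'j \<Rightarrow> 'k :: field"
  assumes "finite I" "finite J"
    and "\<And>x. (\<And>i. i \<in> I \<Longrightarrow> (\<Sum>j\<in>J. A i j * x j) = 0) \<Longrightarrow> (\<Sum>j\<in>J. b j * x j) = 0"
  shows "\<exists>y. \<forall>j\<in>J. b j = (\<Sum>i\<in>I. y i * A i j)"
  using assms(1,3)
proof (induction I arbitrary: b rule: finite_induct)
  case empty
  have "b j = 0" if "j \<in> J" for j
    using empty[of "\<lambda>i. if i = j then 1 else 0"] that assms(2) by (simp add: if_distrib cong: if_cong)
  then show ?case by auto
next
  case (insert i I)
  show ?case
  proof (cases "\<forall>x. (\<forall>i'\<in>I. (\<Sum>j\<in>J. A i' j * x j) = 0) \<longrightarrow> (\<Sum>j\<in>J. A i j * x j) = 0")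
    case True
    then have "\<And>x. (\<And>i'. i' \<in> I \<Longrightarrow> (\<Sum>j\<in>J. A i' j * x j) = 0) \<Longrightarrow> (\<Sum>j\<in>J. b j * x j) = 0"
      using insert.prems by blast
    from insert.IH[OF this] obtain y where y: "\<forall>j\<in>J. b j = (\<Sum>i\<in>I. y i * A i j)" by blast
    have "(\<Sum>i'\<in>insert i I. (if i' = i then 0 else y i') * A i' j) = (\<Sum>i'\<in>I. y i' * A i' j)" for j
    proof -
      have "(\<Sum>i'\<in>I. (if i' = i then 0 else y i') * A i' j) = (\<Sum>i'\<in>I. y i' * A i' j)"
        using insert.hyps by (intro sum.cong) auto
      then show ?thesis using insert.hyps by simp
    qed
    then show ?thesis using y by (intro exI[of _ "\<lambda>i'. if i' = i then 0 else y i'"]) simp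
  next
    case False
    then obtain x1 where x1: "\<And>i'. i' \<in> I \<Longrightarrow> (\<Sum>j\<in>J. A i' j * x1 j) = 0"
      "(\<Sum>j\<in>J. A i j * x1 j) \<noteq> 0" by blast
    define s where "s = (\<Sum>j\<in>J. A i j * x1 j)"
    \<comment> \<open>This multiple makes \<open>b - t * A i\<close> vanish at
      \<open>x1\<close>.\<close>
    define t where "t = (\<Sum>j\<in>J. b j * x1 j) / s"
    have s: "s \<noteq> 0" using x1 s_def by simp
    have "(\<Sum>j\<in>J. (b j - t * A i j) * x j) = 0"
      if x: "\<And>i'. i' \<in> I \<Longrightarrow> (\<Sum>j\<in>J. A i' j * x j) = 0" for x
    proof -
      \<comment> \<open>Correcting \<open>x\<close> by \<open>u * x1\<close> makes row
        \<open>i\<close> vanish too without disturbing the rows in \<open>I\<close>, so the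
        hypothesis on \<open>b\<close> applies.\<close>
      define u where "u = (\<Sum>j\<in>J. A i j * x j) / s"
      have lin: "(\<Sum>j\<in>J. a j * (x j - u * x1 j)) = (\<Sum>j\<in>J. a j * x j) - u * (\<Sum>j\<in>J. a j * x1 j)" for a
        by (simp add: sum_subtractf sum_distrib_left algebra_simps)
      have "(\<Sum>j\<in>J. b j * (x j - u * x1 j)) = 0"
      proof (rule insert.prems)
        fix i' assume "i' \<in> insert i I"
        then show "(\<Sum>j\<in>J. A i' j * (x j - u * x1 j)) = 0"
          unfolding lin using x x1(1) s by (auto simp: u_def s_def[symmetric])
      qed
      then have "(\<Sum>j\<in>J. b j * x j) = u * (\<Sum>j\<in>J. b j * x1 j)" unfolding lin by simp
      also have "\<dots> = t * (\<Sum>j\<in>J. A i j * x j)" by (simp add: u_def t_def)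
      finally show ?thesis by (simp add: sum_subtractf sum_distrib_left algebra_simps)
    qed
    from insert.IH[OF this] obtain y where y: "\<forall>j\<in>J. b j - t * A i j = (\<Sum>i\<in>I. y i * A i j)" by blast
    have "b j = (\<Sum>i'\<in>insert i I. (if i' = i then t else y i') * A i' j)" if "j \<in> J" for j
    proof -
      have "(\<Sum>i'\<in>I. (if i' = i then t else y i') * A i' j) = (\<Sum>i'\<in>I. y i' * A i' j)"
        using insert.hyps by (intro sum.cong) auto
      moreover have "b j = t * A i j + (\<Sum>i\<in>I. y i * A i j)"
        using bspec[OF y that] by (simp add: algebra_simps)
      ultimately show ?thesis using insert.hyps by simp
    qed
    then show ?thesis by (intro exI[of _ "\<lambda>i'. if i' = i then t else y i'"] ballI)
  qed
qed

context matroid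
begin

text \<open>Multiplication by \<open>X_var e\<close> in coordinates: if \<open>c\<close> gives the
  coefficients of an element in the basis \<open>y\<^sub>F\<close>, this is the coefficient of the
  product at \<open>y\<^sub>G\<close>.\<close>

definition act :: "'e \<Rightarrow> ('e set \<Rightarrow> 'k :: comm_ring_1) \<Rightarrow> 'e set \<Rightarrow> 'k" where
  "act e c G = (\<Sum>F | F \<in> Fl \<and> e \<notin> F \<and> cl (insert e F) = G. c F)"

text \<open>Deleting an element from a basis of \<open>z\<close> and closing up gives a lower cover.
  Two deletions differ, because each closure misses its own deleted element and keeps the
  other.\<close>

lemma two_lower_covers:
  assumes "z \<in> Fl" "r z \<ge> 2"
  shows "2 \<le> card {w \<in> Fl. w \<subseteq> z \<and> r w + 1 = r z}"
proof -
  obtain B where B: "B \<in> \<F>" "cl B = z" using flat_basis assms by blast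
  have BE: "B \<subseteq> E" using B indep_subset by blast
  have fin: "finite B" using B indep_finite by blast
  have rz: "r z = card B" using B rank_clos BE rank_indep by metis
  then obtain e f where ef: "e \<in> B" "f \<in> B" "e \<noteq> f"
    using assms by (metis card_le_Suc0_iff_eq fin numeral_2_eq_2 not_less_eq_eq)
  let ?w = "\<lambda>e. cl (B - {e})"
  have w: "?w x \<in> Fl" "?w x \<subseteq> z" "r (?w x) + 1 = r z" "x \<notin> ?w x" if "x \<in> B" for x
  proof -
    show "?w x \<in> Fl" using BE by (intro clos_in_flats) auto
    show "?w x \<subseteq> z" unfolding B(2)[symmetric] by (rule clos_mono) auto
    have i: "B - {x} \<in> \<F>" using B indep_mono by blast
    have "r (?w x) = card (B - {x})" using rank_clos[of "B - {x}"] rank_indep[OF i] BE by auto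
    then show "r (?w x) + 1 = r z" using that fin rz card_Suc_Diff1[of B x] by simp
    show "x \<notin> ?w x" using indep_insert_clos_iff[of x "B - {x}"] that BE B(1) by (auto simp: insert_absorb)
  qed
  have "f \<in> ?w e" using subset_clos[of "B - {e}"] BE ef by auto
  then have "?w e \<noteq> ?w f" using w(4) ef by auto
  then have "2 = card {?w e, ?w f}" by simp
  also have "\<dots> \<le> card {w \<in> Fl. w \<subseteq> z \<and> r w + 1 = r z}"
    using w ef finite_flats by (intro card_mono) auto
  finally show ?thesis .
qed

text \<open>The socle in coordinates: what all variables kill is a multiple of
  \<open>y\<^sub>E\<close>. The type argument selects the coefficient ring.\<close>

definition trivial_socle :: "'k :: comm_ring_1 itself \<Rightarrow> bool" where
  "trivial_socle _ \<longleftrightarrow> (\<forall>c :: 'e set \<Rightarrow> 'k.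
     (\<forall>e\<in>E. \<forall>G. act e c G = 0) \<longrightarrow> (\<forall>F\<in>Fl. F \<noteq> E \<longrightarrow> c F = 0))"

lemma modular_imp_trivial_socle:
  fixes c :: "'e set \<Rightarrow> 'k :: field_char_0"
  assumes mod: "\<And>X Y. X \<in> Fl \<Longrightarrow> Y \<in> Fl \<Longrightarrow> r X + r Y = r (X \<inter> Y) + r (cl (X \<union> Y))"
    and act: "\<And>e G. e \<in> E \<Longrightarrow> act e c G = 0"
    and F: "F \<in> Fl" "F \<noteq> E"
  shows "c F = 0"
proof -
  \<comment> \<open>Closing up \<open>F\<close> with a further element yields a flat
    \<open>G\<close> covering it, so \<open>c F\<close> is one of the coefficients summed over
    \<open>Hs\<close>.\<close>
  obtain e0 where e0: "e0 \<in> E" "e0 \<notin> F" using F flats_subset by blast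
  define G where "G = cl (insert e0 F)"
  have FE: "F \<subseteq> E" using F flats_subset by blast
  have G: "G \<in> Fl" unfolding G_def using FE e0 by (intro clos_in_flats) auto
  have GE: "G \<subseteq> E" using G flats_subset by blast
  have FG: "F \<subseteq> G" unfolding G_def using subset_clos[of "insert e0 F"] FE e0 by auto
  have rG: "r G = r F + 1" unfolding G_def
    using rank_clos[of "insert e0 F"] flat_insert_rank[of F e0] F FE e0 by auto
  define Hs where "Hs = {H \<in> Fl. H \<subseteq> G \<and> r H + 1 = r G}"
  have finHs: "finite Hs" using finite_flats by (auto simp: Hs_def)
  have FHs: "F \<in> Hs" using F FG rG by (auto simp: Hs_def)
  define h where "h z = (\<Sum>H | H \<in> Hs \<and> z \<subseteq> H. c H)" for z
  define tot where "tot = (\<Sum>H\<in>Hs. c H)"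
  \<comment> \<open>This is the coordinate at \<open>G\<close> of the relation for \<open>e\<close>:
    the flats avoiding \<open>e\<close> that span \<open>G\<close> with it are exactly the members
    of \<open>Hs\<close> avoiding \<open>e\<close>.\<close>
  have avoid: "(\<Sum>H | H \<in> Hs \<and> e \<notin> H. c H) = 0" if "e \<in> G" for e
  proof -
    have eE: "e \<in> E" using that GE by auto
    have "{H \<in> Fl. e \<notin> H \<and> cl (insert e H) = G} = {H. H \<in> Hs \<and> e \<notin> H}"
    proof (intro Set.set_eqI iffI)
      fix H assume "H \<in> {H \<in> Fl. e \<notin> H \<and> cl (insert e H) = G}"
      then have H: "H \<in> Fl" "e \<notin> H" "cl (insert e H) = G" by auto
      have iE: "insert e H \<subseteq> E" using flats_subset H eE by auto
      have "r G = r H + 1" using rank_clos[OF iE] flat_insert_rank H eE by simp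
      moreover have "H \<subseteq> G" using subset_clos[OF iE] H by auto
      ultimately show "H \<in> {H. H \<in> Hs \<and> e \<notin> H}" using H by (auto simp: Hs_def)
    next
      fix H assume "H \<in> {H. H \<in> Hs \<and> e \<notin> H}"
      then have H: "H \<in> Fl" "e \<notin> H" "H \<subseteq> G" "r H + 1 = r G" by (auto simp: Hs_def)
      have "cl (insert e H) = cl G"
        using H that GE flat_insert_rank[of H e] eE by (intro clos_eqI) auto
      then show "H \<in> {H \<in> Fl. e \<notin> H \<and> cl (insert e H) = G}" using H clos_flat G by auto
    qed
    then show ?thesis using act[OF eE, of G] by (simp add: act_def)
  qed
  have through: "(\<Sum>H | H \<in> Hs \<and> e \<in> H. c H) = tot" if "e \<in> G" for e
  proof -
    have "tot = (\<Sum>H | H \<in> Hs \<and> e \<in> H. c H) + (\<Sum>H | H \<in> Hs \<and> e \<notin> H. c H)"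
      unfolding tot_def using finHs
      by (subst sum.union_disjoint[symmetric]) (auto intro: sum.cong)
    then show ?thesis using avoid[OF that] by simp
  qed
  \<comment> \<open>Strong induction on \<open>r z\<close>: rank 0 gives the full sum, rank 1 is
    \<open>through\<close>, and from rank 2 on \<open>z\<close> is compared with its lower covers
    \<open>W\<close>.\<close>
  have htot: "h z = tot" if "z \<in> Fl" "z \<subseteq> G" for z
    using that
  proof (induction "r z" arbitrary: z rule: less_induct)
    case less
    obtain B where B: "B \<in> \<F>" "cl B = z" using flat_basis less by blast
    have BE: "B \<subseteq> E" using B indep_subset by blast
    have rz: "r z = card B" using B rank_clos BE rank_indep by metis
    have zB: "z \<subseteq> H \<longleftrightarrow> B \<subseteq> H" if "H \<in> Hs" for H
      using B(2) clos_subset_flat_iff[of B H] that BE by (auto simp: Hs_def)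
    consider "r z = 0" | "r z = 1" | "r z \<ge> 2" by linarith
    then show ?case
    proof cases
      case 1
      then have "B = {}" using rz indep_finite B by auto
      then have "{H. H \<in> Hs \<and> z \<subseteq> H} = Hs" using zB by auto
      then show ?thesis by (simp add: h_def tot_def)
    next
      case 2
      then obtain e where e: "B = {e}" using rz card_1_singletonE by metis
      then have "{H. H \<in> Hs \<and> z \<subseteq> H} = {H. H \<in> Hs \<and> e \<in> H}" using zB by auto
      moreover have "e \<in> G" using e B less.prems subset_clos[OF BE] by auto
      ultimately show ?thesis using through by (simp add: h_def)
    next
      case 3
      define W where "W = {w \<in> Fl. w \<subseteq> z \<and> r w + 1 = r z}"
      have finW: "finite W" using finite_flats by (auto simp: W_def)
      have card: "card {w \<in> W. w \<subseteq> H} = (if z \<subseteq> H then card W else 1)" if H: "H \<in> Hs" for H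
      proof (cases "z \<subseteq> H")
        case True
        then have "{w \<in> W. w \<subseteq> H} = W" by (auto simp: W_def)
        then show ?thesis using True by simp
      next
        case False
        have H': "H \<in> Fl" "H \<subseteq> G" "r H + 1 = r G" using H by (auto simp: Hs_def)
        define J where "J = cl (H \<union> z)"
        have "H \<union> z \<subseteq> E" using less.prems GE H' by auto
        then have J: "J \<in> Fl" "H \<union> z \<subseteq> J" "J \<subseteq> G"
          unfolding J_def using clos_in_flats[of "H \<union> z"] subset_clos[of "H \<union> z"]
            clos_subset_flat[OF _ G, of "H \<union> z"] H' less.prems by blast+
        have "r H < r J" using J False H' by (intro flat_rank_less) auto
        moreover have "r J \<le> r G" using J by (intro rank_mono)
        ultimately have rJ: "r J = r G" using H' by simp
        \<comment> \<open>The join of \<open>H\<close> and \<open>z\<close> has the rank of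
          \<open>G\<close>, one more than \<open>H\<close>, so modularity makes
          \<open>H \<inter> z\<close> a lower cover of \<open>z\<close> and hence the only one
          inside \<open>H\<close>.\<close>
        have rm: "r (H \<inter> z) + 1 = r z"
          using mod[of H z] H' less.prems rJ by (simp add: J_def)
        have Hz: "H \<inter> z \<in> Fl" using Int_flat H' less.prems by blast
        have "w = H \<inter> z" if "w \<in> W" "w \<subseteq> H" for w
          using that rm Hz by (intro flat_eqI) (auto simp: W_def)
        moreover have "H \<inter> z \<in> W" using rm Hz by (auto simp: W_def)
        ultimately have "{w \<in> W. w \<subseteq> H} = {H \<inter> z}" by blast
        then show ?thesis using False by simp
      qed
      \<comment> \<open>Double counting of pairs of a lower cover \<open>w\<close> and a flat
        \<open>H\<close> above it: \<open>H\<close> occurs \<open>card W\<close> times if it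
        contains \<open>z\<close>, and once otherwise.\<close>
      have "of_nat (card W) * tot = (\<Sum>w\<in>W. h w)"
      proof -
        have "h w = tot" if "w \<in> W" for w using that less.hyps[of w] less.prems by (auto simp: W_def)
        then show ?thesis by simp
      qed
      also have "\<dots> = (\<Sum>w\<in>W. \<Sum>H\<in>Hs. if w \<subseteq> H then c H else 0)"
        unfolding h_def using finHs by (simp add: sum.inter_filter)
      also have "\<dots> = (\<Sum>H\<in>Hs. \<Sum>w\<in>W. if w \<subseteq> H then c H else 0)" by (rule sum.swap)
      also have "\<dots> = (\<Sum>H\<in>Hs. of_nat (card {w \<in> W. w \<subseteq> H}) * c H)"
        using finW by (simp add: sum.inter_filter[symmetric])
      also have "\<dots> = (\<Sum>H\<in>Hs. c H + (of_nat (card W) - 1) * (if z \<subseteq> H then c H else 0))"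
        by (rule sum.cong) (auto simp: card algebra_simps)
      also have "\<dots> = tot + (of_nat (card W) - 1) * h z"
        using finHs by (simp add: sum.distrib tot_def h_def sum.inter_filter sum_distrib_left)
      finally have "(of_nat (card W) - 1) * (h z - tot) = 0" by (simp add: algebra_simps)
      \<comment> \<open>Characteristic zero keeps \<open>card W\<close>, which is at least 2,
        different from 1 in the field.\<close>
      moreover have "(of_nat (card W) :: 'k) \<noteq> of_nat 1"
        using two_lower_covers[OF less.prems(1) 3] unfolding of_nat_eq_iff by (simp add: W_def)
      ultimately show ?thesis by simp
    qed
  qed
  \<comment> \<open>No member of \<open>Hs\<close> contains \<open>G\<close>, so the common value is
    0; at \<open>z = F\<close> the only summand is \<open>c F\<close>.\<close>
  have "{H. H \<in> Hs \<and> G \<subseteq> H} = {}" using rank_mono[of G] by (auto simp: Hs_def)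
  then have "h G = 0" unfolding h_def by (simp only: sum.empty)
  then have "tot = 0" using htot[OF G] by simp
  moreover have "{H. H \<in> Hs \<and> F \<subseteq> H} = {F}"
  proof -
    have "F = H" if "H \<in> Hs" "F \<subseteq> H" for H using that F rG by (intro flat_eqI) (auto simp: Hs_def)
    then show ?thesis using FHs by blast
  qed
  then have "h F = c F" by (simp add: h_def)
  ultimately show ?thesis using htot[of F] F FG by simp
qed

end

section \<open>The pairing and its dual bases\<close>

context matroid
begin

text \<open>The coefficient of \<open>y\<^sub>E\<close> in the product of \<open>X_set Z\<close>
  with the element given by \<open>c\<close>; the rank condition says that each factor raises the
  rank by one.\<close>

definition pairing :: "'e set \<Rightarrow> ('e set \<Rightarrow> 'k :: comm_ring_1) \<Rightarrow> 'k" where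
  "pairing Z c = (\<Sum>F | F \<in> Fl \<and> r F + card Z = r E \<and> cl (F \<union> Z) = E. c F)"

text \<open>Associativity of the product: \<open>X_set Z\<close> times \<open>X_var e\<close> is the
  monomial of \<open>insert e Z\<close>, or contains a square and vanishes.\<close>

lemma pairing_act:
  assumes Z: "Z \<subseteq> E" and e: "e \<in> E"
  shows "pairing Z (act e c) = (if e \<in> Z then 0 else pairing (insert e Z) c)"
proof -
  define A where "A = {G \<in> Fl. r G + card Z = r E \<and> cl (G \<union> Z) = E}"
  define S where "S = {F \<in> Fl. e \<notin> F \<and> cl (insert e F) \<in> A}"
  have finA: "finite A" "finite S" using finite_flats by (auto simp: A_def S_def)
  have finZ: "finite Z" using Z finite_ground finite_subset by blast
  have "{F \<in> Fl. e \<notin> F \<and> cl (insert e F) = G} = {F \<in> S. cl (insert e F) = G}" if "G \<in> A" for G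
    using that by (auto simp: S_def)
  then have "pairing Z (act e c) = (\<Sum>G\<in>A. \<Sum>F | F \<in> S \<and> cl (insert e F) = G. c F)"
    unfolding pairing_def act_def A_def[symmetric] by (intro sum.cong) auto
  also have "\<dots> = sum c S" using finA by (intro sum.group) (auto simp: S_def)
  finally have sumS: "pairing Z (act e c) = sum c S" .
  have S: "F \<in> S \<longleftrightarrow> F \<in> Fl \<and> e \<notin> F \<and> r F + 1 + card Z = r E \<and> cl (F \<union> insert e Z) = E" for F
  proof (cases "F \<in> Fl \<and> e \<notin> F")
    case True
    then have iE: "insert e F \<subseteq> E" using flats_subset e by auto
    have "cl (cl (insert e F) \<union> Z) = cl (F \<union> insert e Z)"
      using clos_Un_clos[OF iE Z] by simp
    then show ?thesis using True clos_in_flats[OF iE] rank_clos[OF iE] flat_insert_rank[of F e] e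
      by (simp add: S_def A_def)
  qed (auto simp: S_def)
  \<comment> \<open>With \<open>e\<close> already in \<open>F\<close> or \<open>Z\<close>, these two
    alone span \<open>E\<close>, so \<open>r E\<close> is at most \<open>r F + card Z\<close>;
    membership of \<open>F\<close> in \<open>S\<close> asks for one more.\<close>
  have bound: "r E \<le> r F + card Z" if "F \<in> Fl" "e \<in> F \<or> e \<in> Z" "cl (F \<union> insert e Z) = E" for F
  proof -
    have eq: "F \<union> insert e Z = F \<union> Z" using that by auto
    have "r (cl (F \<union> Z)) = r (F \<union> Z)" using flats_subset Z that(1) by (intro rank_clos) auto
    then show ?thesis using that(3) rank_Un_le[OF finZ, of F] by (simp only: eq)
  qed
  show ?thesis
  proof (cases "e \<in> Z")
    case True
    then have "S = {}" using bound S by fastforce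
    then show ?thesis using sumS True by simp
  next
    case False
    then have "S = {F \<in> Fl. r F + card (insert e Z) = r E \<and> cl (F \<union> insert e Z) = E}"
      using S bound finZ by fastforce
    then show ?thesis using sumS False by (simp add: pairing_def)
  qed
qed

text \<open>Induction on \<open>k\<close>, where \<open>c\<close> vanishes on flats of corank at
  least \<open>k\<close>. Multiplication by a variable raises the rank, so the products of
  \<open>c\<close> with variables satisfy the hypotheses for a smaller \<open>k\<close> and vanish.
  The trivial socle then leaves only \<open>c E\<close>, which the pairing with \<open>{}\<close>
  reads off.\<close>

lemma pairing_nondegenerate:
  fixes c :: "'e set \<Rightarrow> 'k :: comm_ring_1"
  assumes socle: "trivial_socle TYPE('k)" and c: "\<And>Z. Z \<subseteq> E \<Longrightarrow> pairing Z c = 0" and F: "F \<in> Fl"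
  shows "c F = 0"
proof -
  have "\<forall>F\<in>Fl. c F = 0"
    if "\<And>Z. Z \<subseteq> E \<Longrightarrow> pairing Z c = 0" "\<And>F. F \<in> Fl \<Longrightarrow> r F + k \<le> r E \<Longrightarrow> c F = 0"
    for k and c :: "'e set \<Rightarrow> 'k"
    using that
  proof (induction k arbitrary: c)
    case 0
    then show ?case using rank_mono[OF flats_subset] by auto
  next
    case (Suc k)
    have act0: "act e c G = 0" if e: "e \<in> E" for e G
    proof (cases "G \<in> Fl")
      case True
      have "\<forall>G\<in>Fl. act e c G = 0"
      proof (rule Suc.IH)
        fix Z assume "Z \<subseteq> E"
        then show "pairing Z (act e c) = 0"
          using Suc.prems(1)[of "insert e Z"] e by (simp add: pairing_act)
      next
        fix G assume G: "G \<in> Fl" "r G + k \<le> r E"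
        have "c F = 0" if "F \<in> Fl" "e \<notin> F" "cl (insert e F) = G" for F
        proof -
          have "r G = r F + 1" using that rank_clos[of "insert e F"] flat_insert_rank e flats_subset by simp
          then show ?thesis using Suc.prems(2)[of F] G that by simp
        qed
        then show "act e c G = 0" by (simp add: act_def)
      qed
      then show ?thesis using True by blast
    next
      case False
      then have "{F \<in> Fl. e \<notin> F \<and> cl (insert e F) = G} = {}"
        using clos_in_flats flats_subset e by auto
      then show ?thesis unfolding act_def by (simp only: sum.empty)
    qed
    then have *: "\<And>F. F \<in> Fl \<Longrightarrow> F \<noteq> E \<Longrightarrow> c F = 0" using socle unfolding trivial_socle_def by blast
    have "{F \<in> Fl. r F + card {} = r E \<and> cl (F \<union> {}) = E} = {E}"
      using ground_flat clos_flat by auto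
    then have "c E = 0" using Suc.prems(1)[of "{}"] by (simp add: pairing_def)
    then show ?case using * by metis
  qed
  \<comment> \<open>With \<open>k = r E + 1\<close> no flat satisfies
    \<open>r F + k \<le> r E\<close>, so the support condition is vacuous.\<close>
  from this[of c "r E + 1"] show ?thesis using c F by simp
qed

section \<open>Dual bases for hyperplanes and for lines through a point\<close>

lemma clos_insert_hyperplane:
  assumes "H \<in> Fl" "r H + 1 = r E" "e \<in> E" "e \<notin> H"
  shows "cl (insert e H) = E"
proof -
  have "cl (insert e H) = cl E"
    using assms flats_subset flat_insert_rank[of H e] by (intro clos_eqI) auto
  then show ?thesis using clos_flat ground_flat by simp
qed

text \<open>Take the matrix of elements against hyperplanes with entry 1 for
  \<open>e \<notin> H\<close>. A vector in its kernel, extended by zero, is killed by all variables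
  and hence is zero, so the coordinate at \<open>H0\<close> is a combination of rows, with
  coefficients \<open>a\<close>.\<close>

lemma hyperplane_dual:
  assumes socle: "trivial_socle TYPE('k :: field)" and H0: "H0 \<in> Fl" "r H0 + 1 = r E"
  obtains a :: "'e \<Rightarrow> 'k :: field" where
    "\<And>H. H \<in> Fl \<Longrightarrow> r H + 1 = r E \<Longrightarrow> (\<Sum>e\<in>E - H. a e) = (if H = H0 then 1 else 0)"
proof -
  define Hy where "Hy = {H \<in> Fl. r H + 1 = r E}"
  have fin: "finite Hy" using finite_flats by (simp add: Hy_def)
  have H0': "H0 \<in> Hy" using H0 by (simp add: Hy_def)
  have HE: "H \<noteq> E" if "H \<in> Hy" for H using that by (auto simp: Hy_def)
  let ?A = "\<lambda>e H. if e \<in> H then 0 else 1 :: 'k" and ?b = "\<lambda>H. if H = H0 then 1 else 0 :: 'k"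
  have "\<exists>y. \<forall>H\<in>Hy. ?b H = (\<Sum>e\<in>E. y e * ?A e H)"
  proof (rule linear_combination_of_functionals[OF finite_ground fin])
    fix x :: "'e set \<Rightarrow> 'k" assume x: "\<And>e. e \<in> E \<Longrightarrow> (\<Sum>H\<in>Hy. ?A e H * x H) = 0"
    define c where "c H = (if H \<in> Hy then x H else 0)" for H
    have "act e c G = 0" if e: "e \<in> E" for e G
    proof -
      let ?S = "{F \<in> Fl. e \<notin> F \<and> cl (insert e F) = G}"
      have "act e c G = (\<Sum>H\<in>?S \<inter> Hy. x H)"
        unfolding act_def c_def using finite_flats by (simp add: sum.inter_restrict)
      \<comment> \<open>A hyperplane and an element outside it span \<open>E\<close>, so only the
        coordinate at \<open>E\<close> needs the hypothesis, and there the sum is the row of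
        \<open>e\<close> applied to \<open>x\<close>.\<close>
      also have "\<dots> = 0"
      proof (cases "G = E")
        case True
        then have "?S \<inter> Hy = {H \<in> Hy. e \<notin> H}"
          using e clos_insert_hyperplane by (auto simp: Hy_def)
        then have "(\<Sum>H\<in>?S \<inter> Hy. x H) = (\<Sum>H\<in>Hy. if e \<notin> H then x H else 0)"
          using fin by (simp add: sum.inter_filter)
        also have "\<dots> = (\<Sum>H\<in>Hy. ?A e H * x H)" by (rule sum.cong) auto
        finally show ?thesis using x[OF e] by simp
      next
        case False
        then have "?S \<inter> Hy = {}" using e clos_insert_hyperplane by (auto simp: Hy_def)
        then show ?thesis by (metis sum.empty)
      qed
      finally show ?thesis .
    qed
    then have "c H0 = 0" using socle H0 HE[OF H0'] unfolding trivial_socle_def by blast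
    then have "x H0 = 0" using H0' by (simp add: c_def)
    then show "(\<Sum>H\<in>Hy. ?b H * x H) = 0" by (intro sum.neutral) auto
  qed
  then obtain y where y: "\<forall>H\<in>Hy. ?b H = (\<Sum>e\<in>E. y e * ?A e H)" by blast
  have "(\<Sum>e\<in>E - H. y e) = (if H = H0 then 1 else 0)" if "H \<in> Fl" "r H + 1 = r E" for H
  proof -
    have "(\<Sum>e\<in>E - H. y e) = (\<Sum>e\<in>E. if e \<notin> H then y e else 0)"
      using finite_ground by (simp add: sum.inter_filter[symmetric] set_diff_eq)
    also have "\<dots> = (\<Sum>e\<in>E. y e * ?A e H)" by (rule sum.cong) auto
    also have "\<dots> = ?b H" using y that by (simp add: Hy_def)
    finally show ?thesis .
  qed
  then show thesis using that by blast
qed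

text \<open>A non-loop has rank 1, so its closure exhausts \<open>cl {e}\<close>, whose rank is at
  most 1.\<close>

lemma clos_singleton_eq:
  assumes "e \<in> E" "x \<in> cl {e}" "x \<notin> cl {}"
  shows "cl {x} = cl {e}"
proof (rule flat_eqI)
  have x: "x \<in> E" using assms clos_subset by blast
  then show "cl {x} \<in> Fl" "cl {e} \<in> Fl" using assms clos_in_flats by auto
  then show "cl {x} \<subseteq> cl {e}" using assms clos_subset_flat[of "{x}"] by auto
  have "r {x} = 1" using not_in_closD[OF x assms(3)] by simp
  moreover have "r {e} \<le> 1" using rank_le_card[of "{e}"] by simp
  ultimately show "r (cl {e}) \<le> r (cl {x})" using rank_clos x assms by simp
qed

lemma line_through:
  assumes "p \<in> E" "p \<notin> cl {}" "q \<in> E" "q \<notin> cl {p}"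
  shows "cl {p, q} \<in> Fl" "r (cl {p, q}) = 2" "p \<in> cl {p, q}" "q \<in> cl {p, q}"
proof -
  have sub: "{p, q} \<subseteq> E" using assms by auto
  show "cl {p, q} \<in> Fl" "p \<in> cl {p, q}" "q \<in> cl {p, q}"
    using clos_in_flats[OF sub] subset_clos[OF sub] by auto
  have "r {p} = 1" using not_in_closD[OF assms(1,2)] by simp
  moreover have "r {q, p} = r {p} + 1" using not_in_closD[OF assms(3,4)] .
  ultimately show "r (cl {p, q}) = 2" using rank_clos[OF sub] by (simp add: insert_commute)
qed

text \<open>The same duality for hyperplanes against lines, all through \<open>p\<close>, with entry
  1 if the line is not inside the hyperplane. A kernel vector pairs to 0 with every \<open>Z\<close>
  and so is zero by nondegeneracy. An element \<open>q\<close> outside \<open>cl {p}\<close>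
  represents the line through \<open>p\<close> and \<open>q\<close>.\<close>

lemma line_dual:
  assumes socle: "trivial_socle TYPE('k :: field)" and p: "p \<in> E" "p \<notin> cl {}"
    and l: "l \<in> Fl" "r l = 2" "p \<in> l"
  obtains c :: "'e set \<Rightarrow> 'k :: field" where
    "\<And>q. q \<in> E \<Longrightarrow> (\<Sum>K | K \<in> Fl \<and> r K + 1 = r E \<and> p \<in> K \<and> q \<notin> K. c K)
       = (if q \<in> l - cl {p} then 1 else 0)"
proof -
  define Hp where "Hp = {K \<in> Fl. r K + 1 = r E \<and> p \<in> K}"
  define Lp where "Lp = {L \<in> Fl. r L = 2 \<and> p \<in> L}"
  have fin: "finite Hp" "finite Lp" using finite_flats by (simp_all add: Hp_def Lp_def)
  have lLp: "l \<in> Lp" using l by (simp add: Lp_def)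
  let ?A = "\<lambda>K L. if L \<subseteq> K then 0 else 1 :: 'k" and ?b = "\<lambda>L. if L = l then 1 else 0 :: 'k"
  have pcl: "cl {p} \<subseteq> K" if "K \<in> Fl" "p \<in> K" for K
    using clos_subset_flat[of "{p}" K] that by auto
  have "\<exists>y. \<forall>L\<in>Lp. ?b L = (\<Sum>K\<in>Hp. y K * ?A K L)"
  proof (rule linear_combination_of_functionals[OF fin])
    fix x :: "'e set \<Rightarrow> 'k" assume x: "\<And>K. K \<in> Hp \<Longrightarrow> (\<Sum>L\<in>Lp. ?A K L * x L) = 0"
    define c where "c L = (if L \<in> Lp then x L else 0)" for L
    have "pairing Z c = 0" if Z: "Z \<subseteq> E" for Z
    proof -
      let ?S = "{F \<in> Fl. r F + card Z = r E \<and> cl (F \<union> Z) = E}"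
      have finZ: "finite Z" using Z finite_ground finite_subset by blast
      have "pairing Z c = (\<Sum>L\<in>?S \<inter> Lp. x L)"
        unfolding pairing_def c_def using finite_flats by (simp add: sum.inter_restrict)
      also have "\<dots> = 0"
      \<comment> \<open>If some line contributes, \<open>Z\<close> has \<open>r E - 2\<close>
        elements and spans a hyperplane \<open>K\<close> together with \<open>p\<close>; the sum is
        then row \<open>K\<close> applied to \<open>x\<close>.\<close>
      proof (cases "?S \<inter> Lp = {}")
        case False
        then obtain L0 where L0: "L0 \<in> Lp" "L0 \<in> ?S" by blast
        then have cZ: "2 + card Z = r E" by (simp add: Lp_def)
        define K where "K = cl (insert p Z)"
        have iE: "insert p Z \<subseteq> E" using Z p by simp
        have K: "K \<in> Fl" "p \<in> K" "Z \<subseteq> K" unfolding K_def using clos_in_flats[OF iE] subset_clos[OF iE] by auto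
        \<comment> \<open>\<open>L\<close> and \<open>K\<close> share the closure of
          \<open>p\<close>, of rank 1, and together span \<open>E\<close>; submodularity bounds
          \<open>r K\<close> from below.\<close>
        have LK: "r E \<le> r K + 1" if L: "L \<in> Lp" "L \<in> ?S" for L
        proof -
          have "r L + r (cl {p}) \<ge> r L + 1"
            using not_in_closD[OF p] rank_clos[of "{p}"] p by simp
          moreover have "cl {p} \<subseteq> L \<inter> K" using pcl L K by (auto simp: Lp_def)
          then have "r (cl {p}) \<le> r (L \<inter> K)" by (rule rank_mono)
          moreover have "r (L \<union> K) + r (L \<inter> K) \<le> r L + r K" by (rule rank_submod)
          moreover have "r E \<le> r (L \<union> K)"
          proof -
            have "r E = r (L \<union> Z)" using rank_clos[of "L \<union> Z"] L Z flats_subset by auto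
            also have "\<dots> \<le> r (L \<union> K)" using K by (intro rank_mono) auto
            finally show ?thesis .
          qed
          moreover have "r L = 2" using L by (simp add: Lp_def)
          ultimately show ?thesis by linarith
        qed
        have "r K = r (insert p Z)" unfolding K_def using rank_clos[OF iE] .
        also have "\<dots> \<le> card (insert p Z)" using finZ by (intro rank_le_card) auto
        also have "\<dots> \<le> card Z + 1" using finZ by (simp add: card_insert_if)
        finally have rK: "r K + 1 = r E" using LK[OF L0] cZ by simp
        then have KHp: "K \<in> Hp" using K by (simp add: Hp_def)
        \<comment> \<open>A line inside \<open>K\<close> spans with \<open>Z\<close> nothing beyond
          \<open>K\<close>. A line leaving \<open>K\<close> still contains \<open>p\<close>, so its
          span with \<open>Z\<close> properly contains \<open>K\<close> and is
          \<open>E\<close>.\<close>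
        have "L \<in> ?S \<longleftrightarrow> \<not> L \<subseteq> K" if L: "L \<in> Lp" for L
        proof
          assume "L \<in> ?S"
          then have LZ: "cl (L \<union> Z) = E" by simp
          show "\<not> L \<subseteq> K"
          proof
            assume "L \<subseteq> K"
            then have "E \<subseteq> K" using clos_subset_flat[of "L \<union> Z" K] K LZ by simp
            then show False using rank_mono[of E K] rK by simp
          qed
        next
          assume "\<not> L \<subseteq> K"
          then obtain f where f: "f \<in> L" "f \<notin> K" by blast
          have L': "L \<in> Fl" "r L = 2" "p \<in> L" using L by (auto simp: Lp_def)
          have fE: "f \<in> E" using f flats_subset L' by blast
          have LZE: "L \<union> Z \<subseteq> E" using flats_subset L' Z by blast
          have "insert p Z \<subseteq> cl (L \<union> Z)" using subset_clos[OF LZE] L' by auto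
          then have "K \<subseteq> cl (L \<union> Z)" unfolding K_def using clos_in_flats[OF LZE] by (rule clos_subset_flat)
          then have "insert f K \<subseteq> cl (L \<union> Z)" using subset_clos[OF LZE] f by auto
          then have "cl (insert f K) \<subseteq> cl (L \<union> Z)" using clos_in_flats[OF LZE] by (rule clos_subset_flat)
          then have "cl (L \<union> Z) = E"
            using clos_insert_hyperplane[OF K(1) rK fE f(2)] clos_subset by blast
          then show "L \<in> ?S" using L' cZ by simp
        qed
        then have "?S \<inter> Lp = {L \<in> Lp. \<not> L \<subseteq> K}" by blast
        then have "(\<Sum>L\<in>?S \<inter> Lp. x L) = (\<Sum>L\<in>Lp. if \<not> L \<subseteq> K then x L else 0)"
          using fin by (simp only: sum.inter_filter)
        also have "\<dots> = (\<Sum>L\<in>Lp. ?A K L * x L)" by (rule sum.cong) auto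
        finally show ?thesis using x[OF KHp] by simp
      qed (metis sum.empty)
      finally show ?thesis .
    qed
    then have "c l = 0" using pairing_nondegenerate[OF socle] l by blast
    then have "x l = 0" using lLp by (simp add: c_def)
    then show "(\<Sum>L\<in>Lp. ?b L * x L) = 0" by (intro sum.neutral) auto
  qed
  then obtain y where y: "\<forall>L\<in>Lp. ?b L = (\<Sum>K\<in>Hp. y K * ?A K L)" by blast
  have "(\<Sum>K | K \<in> Fl \<and> r K + 1 = r E \<and> p \<in> K \<and> q \<notin> K. y K) = (if q \<in> l - cl {p} then 1 else 0)"
    if q: "q \<in> E" for q
  proof -
    have eq: "{K \<in> Fl. r K + 1 = r E \<and> p \<in> K \<and> q \<notin> K} = {K \<in> Hp. q \<notin> K}" by (auto simp: Hp_def)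
    show ?thesis
    proof (cases "q \<in> cl {p}")
      case True
      \<comment> \<open>Every hyperplane through \<open>p\<close> contains \<open>cl {p}\<close>, so
        both sides are 0.\<close>
      then have "{K \<in> Hp. q \<notin> K} = {}" using pcl by (auto simp: Hp_def)
      then show ?thesis unfolding eq using True by (simp only: sum.empty) simp
    next
      case False
      note L = line_through[OF p q False]
      have iff: "cl {p, q} \<subseteq> K \<longleftrightarrow> q \<in> K" if "K \<in> Hp" for K
        using that clos_subset_flat_iff[of "{p, q}" K] p q by (auto simp: Hp_def)
      have "cl {p, q} = l \<longleftrightarrow> q \<in> l"
      proof
        assume "q \<in> l"
        then have "cl {p, q} \<subseteq> l" using l clos_subset_flat[of "{p, q}" l] by auto
        then show "cl {p, q} = l" using L l by (intro flat_eqI) auto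
      qed (use L in auto)
      moreover have "cl {p, q} \<in> Lp" using L by (simp add: Lp_def)
      ultimately have "(if q \<in> l - cl {p} then 1 else 0) = (\<Sum>K\<in>Hp. y K * ?A K (cl {p, q}))"
        using bspec[OF y, of "cl {p, q}"] False by simp
      also have "\<dots> = (\<Sum>K\<in>Hp. if q \<notin> K then y K else 0)" by (rule sum.cong) (auto simp: iff)
      also have "\<dots> = (\<Sum>K | K \<in> Hp \<and> q \<notin> K. y K)" using fin by (simp add: sum.inter_filter)
      finally show ?thesis unfolding eq by simp
    qed
  qed
  then show thesis using that by blast
qed

end

section \<open>A trivial socle forces modularity\<close>

context matroid
begin

text \<open>The fibres on \<open>S\<close> of the map taking \<open>e\<close> to
  \<open>cl {e}\<close> are rank-one flats without their loops, and each contributes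
  \<open>\<beta>\<close>.\<close>

lemma sum_over_points:
  fixes a :: "'e \<Rightarrow> 'k :: comm_ring_1"
  assumes S: "S \<subseteq> E" "S \<inter> cl {} = {}" "\<And>e. e \<in> S \<Longrightarrow> cl {e} - cl {} \<subseteq> S"
    and const: "\<And>e. e \<in> S \<Longrightarrow> sum a (cl {e} - cl {}) = \<beta>"
  shows "sum a S = of_nat (card ((\<lambda>e. cl {e}) ` S)) * \<beta>"
proof -
  have fin: "finite S" using S finite_ground finite_subset by blast
  have "{x \<in> S. cl {x} = cl {e}} = cl {e} - cl {}" if e: "e \<in> S" for e
  proof (intro equalityI subsetI)
    fix x assume "x \<in> {x \<in> S. cl {x} = cl {e}}"
    then show "x \<in> cl {e} - cl {}" using S(1,2) subset_clos[of "{x}"] by blast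
  next
    fix x assume x: "x \<in> cl {e} - cl {}"
    then show "x \<in> {x \<in> S. cl {x} = cl {e}}" using clos_singleton_eq[of e x] S e by blast
  qed
  then have "sum a S = (\<Sum>P\<in>(\<lambda>e. cl {e}) ` S. \<beta>)"
    unfolding sum.image_gen[OF fin, of a "\<lambda>e. cl {e}"] using const by (intro sum.cong) auto
  then show ?thesis by simp
qed

lemma line_meets_hyperplane:
  assumes socle: "trivial_socle TYPE('k :: field_char_0)"
    and l: "l \<in> Fl" "r l = 2" and H: "H \<in> Fl" "r H + 1 = r E"
  shows "r (l \<inter> H) \<noteq> 0"
proof
  assume r0: "r (l \<inter> H) = 0"
  have loops: "cl {} \<subseteq> F" if "F \<in> Fl" for F using clos_subset_flat[of "{}" F] that by simp
  have lE: "l \<subseteq> E" and HE: "H \<subseteq> E" using flats_subset l H by auto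
  have lH: "l \<inter> H = cl {}"
    using flat_eqI[of "cl {}" "l \<inter> H"] clos_in_flats[of "{}"] Int_flat[OF l(1) H(1)] loops l H r0 by simp
  obtain a :: "'e \<Rightarrow> 'k" where
    a: "\<And>K. K \<in> Fl \<Longrightarrow> r K + 1 = r E \<Longrightarrow> (\<Sum>e\<in>E - K. a e) = (if K = H then 1 else 0)"
    using hyperplane_dual[OF socle H] by blast
  \<comment> \<open>Loops lie in every flat; removing them makes distinct points disjoint.\<close>
  define \<alpha> where "\<alpha> S = sum a (S - cl {})" for S
  \<comment> \<open>The part of the line \<open>m\<close> off \<open>p\<close> has total mass 0:
    \<open>c\<close> writes its indicator as a combination of complements of hyperplanes through
    \<open>p\<close>. None of these is \<open>H\<close>, so \<open>a\<close> sums to 0 on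
    each.\<close>
  have line: "\<alpha> m = \<alpha> (cl {p})" if p: "p \<in> E" "p \<notin> H" and m: "m \<in> Fl" "r m = 2" "p \<in> m" for p m
  proof -
    have nl: "p \<notin> cl {}" using loops[OF H(1)] p by auto
    obtain c :: "'e set \<Rightarrow> 'k" where
      c: "\<And>q. q \<in> E \<Longrightarrow> (\<Sum>K | K \<in> Fl \<and> r K + 1 = r E \<and> p \<in> K \<and> q \<notin> K. c K)
        = (if q \<in> m - cl {p} then 1 else 0)"
      using line_dual[OF socle p(1) nl m] by blast
    define Hp where "Hp = {K \<in> Fl. r K + 1 = r E \<and> p \<in> K}"
    have fin: "finite Hp" using finite_flats by (simp add: Hp_def)
    have mE: "m \<subseteq> E" using m flats_subset by blast
    have "sum a (m - cl {p}) = (\<Sum>q\<in>E. if q \<in> m - cl {p} then a q else 0)"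
      using finite_ground mE by (simp add: sum.inter_filter[symmetric]) (rule sum.cong, auto)
    also have "\<dots> = (\<Sum>q\<in>E. a q * (\<Sum>K | K \<in> Hp \<and> q \<notin> K. c K))"
      using c by (intro sum.cong) (auto simp: Hp_def conj_assoc)
    also have "\<dots> = (\<Sum>q\<in>E. \<Sum>K\<in>Hp. if q \<notin> K then a q * c K else 0)"
      using fin by (simp add: sum.inter_filter sum_distrib_left if_distrib cong: if_cong)
    also have "\<dots> = (\<Sum>K\<in>Hp. \<Sum>q\<in>E. if q \<notin> K then a q * c K else 0)" by (rule sum.swap)
    also have "\<dots> = (\<Sum>K\<in>Hp. (\<Sum>q\<in>E - K. a q) * c K)"
      using finite_ground by (simp add: sum.inter_filter[symmetric] set_diff_eq sum_distrib_right)
    also have "\<dots> = 0" using a p by (intro sum.neutral) (auto simp: Hp_def)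
    finally have s0: "sum a (m - cl {p}) = 0" .
    have "cl {p} \<subseteq> m" using clos_subset_flat[of "{p}"] m by simp
    then have "m - cl {} = (m - cl {p}) \<union> (cl {p} - cl {})"
      using loops[OF clos_in_flats[of "{p}"]] p by auto
    moreover have "finite m" "finite (cl {p})" using mE clos_subset finite_ground finite_subset by metis+
    moreover have "(m - cl {p}) \<inter> (cl {p} - cl {}) = {}" by auto
    ultimately show ?thesis unfolding \<alpha>_def using s0 by (simp add: sum.union_disjoint)
  qed
  \<comment> \<open>Two distinct points outside \<open>H\<close> span a line, whose mass equals that
    of either point.\<close>
  have const: "\<alpha> (cl {q}) = \<alpha> (cl {p})" if "p \<in> E - H" "q \<in> E - H" for p q
  proof (cases "q \<in> cl {p}")
    case True
    then have "cl {q} = cl {p}" using clos_singleton_eq[of p q] that loops[OF H(1)] by auto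
    then show ?thesis by simp
  next
    case False
    have nl: "p \<notin> cl {}" using loops[OF H(1)] that by auto
    have pq: "p \<in> E" "q \<in> E" "p \<notin> H" "q \<notin> H" using that by auto
    note L = line_through[OF pq(1) nl pq(2) False]
    show ?thesis using line[OF pq(1,3) L(1,2,3)] line[OF pq(2,4) L(1,2,4)] by simp
  qed
  obtain B where B: "B \<in> \<F>" "cl B = l" using flat_basis l by blast
  have BE: "B \<subseteq> E" using B indep_subset by blast
  have "card B = 2" using B l rank_clos[OF BE] rank_indep by metis
  then obtain p q where pq: "B = {p, q}" "p \<noteq> q" by (auto simp: card_2_iff)
  have pqE: "p \<in> E" "q \<in> E" "p \<in> l" "q \<in> l" using pq BE B subset_clos[OF BE] by auto
  have i: "{p} \<in> \<F>" using B(1) by (rule indep_mono) (use pq in auto)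
  have qp: "q \<notin> cl {p}"
    using indep_insert_iff[OF i pqE(2)] B(1) pq by (auto simp: insert_commute)
  have p0: "p \<notin> cl {}" using indep_insert_iff[OF indep_empty pqE(1)] i by simp
  have q0: "q \<notin> cl {}" using qp clos_mono[of "{}" "{p}"] by auto
  have pH: "p \<in> E - H" using pqE p0 lH by auto
  define \<beta> where "\<beta> = \<alpha> (cl {p})"
  \<comment> \<open>As \<open>l\<close> meets \<open>H\<close> in loops alone, every point of
    \<open>l\<close> lies outside \<open>H\<close> and has mass \<open>\<beta>\<close>.\<close>
  have lsum: "\<alpha> l = of_nat (card ((\<lambda>e. cl {e}) ` (l - cl {}))) * \<beta>"
    unfolding \<alpha>_def
  proof (rule sum_over_points)
    show "l - cl {} \<subseteq> E" "(l - cl {}) \<inter> cl {} = {}" using lE by auto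
    fix e assume e: "e \<in> l - cl {}"
    then show "cl {e} - cl {} \<subseteq> l - cl {}" using clos_subset_flat[of "{e}" l] l by auto
    have "e \<in> E - H" using e lE lH by auto
    then show "sum a (cl {e} - cl {}) = \<beta>" using const[OF pH] by (simp add: \<beta>_def \<alpha>_def)
  qed
  have "cl {p} \<noteq> cl {q}" using qp subset_clos[of "{q}"] pqE by auto
  then have "card {cl {p}, cl {q}} = 2" by simp
  moreover have "card {cl {p}, cl {q}} \<le> card ((\<lambda>e. cl {e}) ` (l - cl {}))"
    using pqE p0 q0 finite_subset[OF lE finite_ground] by (intro card_mono) auto
  ultimately have "card ((\<lambda>e. cl {e}) ` (l - cl {})) \<noteq> 1" by linarith
  \<comment> \<open>In characteristic zero the number of points on \<open>l\<close>, at least 2, is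
    not 1 in the field. Since \<open>\<alpha> l\<close> is both \<open>\<beta>\<close> and that
    multiple of \<open>\<beta>\<close>, it follows that \<open>\<beta> = 0\<close>.\<close>
  then have "(of_nat (card ((\<lambda>e. cl {e}) ` (l - cl {}))) :: 'k) \<noteq> 1"
    by (metis of_nat_1 of_nat_eq_iff)
  moreover have "\<alpha> l = \<beta>" using line[of p l] pH l pqE by (simp add: \<beta>_def)
  ultimately have "\<beta> = 0" using lsum by auto
  \<comment> \<open>The total mass outside \<open>H\<close> is a multiple of \<open>\<beta>\<close>,
    but it is 1 by the choice of \<open>a\<close>.\<close>
  have "sum a (E - H) = of_nat (card ((\<lambda>e. cl {e}) ` (E - H))) * \<beta>"
  proof (rule sum_over_points)
    show "E - H \<subseteq> E" "(E - H) \<inter> cl {} = {}" using loops[OF H(1)] by auto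
    fix e assume e: "e \<in> E - H"
    show "sum a (cl {e} - cl {}) = \<beta>" using const[OF pH e] by (simp add: \<beta>_def \<alpha>_def)
    show "cl {e} - cl {} \<subseteq> E - H"
    proof
      fix x assume x: "x \<in> cl {e} - cl {}"
      then have "cl {x} = cl {e}" using clos_singleton_eq[of e x] e by auto
      moreover have "e \<in> cl {e}" using subset_clos[of "{e}"] e by auto
      ultimately have "x \<notin> H" using clos_subset_flat[of "{x}" H] H e by auto
      then show "x \<in> E - H" using x clos_subset by auto
    qed
  qed
  then show False using a[OF H] \<open>\<beta> = 0\<close> by simp
qed

text \<open>If the rank dropped by two, two elements of a basis of \<open>X\<close> extending one of
  \<open>X \<inter> H\<close> would span a line in \<open>X\<close>. By submodularity this line
  would meet \<open>X \<inter> H\<close> in rank 0.\<close>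

lemma hyperplane_section_rank:
  assumes meets: "\<And>l. l \<in> Fl \<Longrightarrow> r l = 2 \<Longrightarrow> r (l \<inter> H) \<noteq> 0"
    and H: "H \<in> Fl" and X: "X \<in> Fl"
  shows "r X \<le> r (X \<inter> H) + 1"
proof (rule ccontr)
  assume "\<not> ?thesis"
  then have big: "r (X \<inter> H) + 2 \<le> r X" by simp
  obtain B where B: "B \<in> \<F>" "B \<subseteq> X \<inter> H" "card B = r (X \<inter> H)" using ex_basis by blast
  obtain C where C: "C \<in> \<F>" "B \<subseteq> C" "C \<subseteq> X" "card C = r X"
    using extend_basis[of B X] B by auto
  have fin: "finite C" using C indep_finite by blast
  then have "card (C - B) \<ge> 2" using B C big finite_subset[of B C] by (simp add: card_Diff_subset)
  then obtain e f where ef: "e \<in> C - B" "f \<in> C - B" "e \<noteq> f"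
    by (metis card_le_Suc0_iff_eq fin finite_Diff not_less_eq_eq numeral_2_eq_2)
  have efE: "{e, f} \<subseteq> E" using ef C indep_subset by blast
  have "{e, f} \<in> \<F>" using C(1) by (rule indep_mono) (use ef in auto)
  then have r2: "r (cl {e, f}) = 2" using rank_clos[OF efE] rank_indep ef by simp
  define l where "l = cl {e, f}"
  have l: "l \<in> Fl" "r l = 2" using clos_in_flats[OF efE] r2 by (auto simp: l_def)
  have lX: "l \<subseteq> X" unfolding l_def using ef C X by (intro clos_subset_flat) auto
  have "r (l \<inter> H) \<noteq> 0" using meets l by blast
  moreover have "l \<inter> (X \<inter> H) = l \<inter> H" using lX by auto
  moreover have "r (l \<union> (X \<inter> H)) + r (l \<inter> (X \<inter> H)) \<le> r l + r (X \<inter> H)" by (rule rank_submod)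
  moreover have "card (insert e (insert f B)) \<le> r (l \<union> (X \<inter> H))"
    using C(1) ef B C subset_clos[OF efE]
    by (intro card_le_rank indep_mono[OF C(1)]) (auto simp: l_def)
  moreover have "card (insert e (insert f B)) = card B + 2"
    using ef finite_subset[OF C(2) fin] by simp
  ultimately show False using l B(3) by simp
qed

text \<open>A basis of \<open>Y\<close> together with \<open>e\<close> extends to a basis
  \<open>C\<close> of \<open>E\<close>; the closure of \<open>C - {e}\<close> contains
  \<open>Y\<close> but not \<open>e\<close>. As \<open>cl (insert e Y)\<close> covers
  \<open>Y\<close>, the intersection can only be \<open>Y\<close>.\<close>

lemma separating_hyperplane:
  assumes Y: "Y \<in> Fl" and e: "e \<in> E" "e \<notin> Y"
  obtains H where "H \<in> Fl" "r H + 1 = r E" "H \<inter> cl (insert e Y) = Y"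
proof -
  obtain B where B: "B \<in> \<F>" "cl B = Y" using flat_basis Y by blast
  have BE: "B \<subseteq> E" using B indep_subset by blast
  have eB: "e \<notin> B" using subset_clos[OF BE] B e by auto
  have "insert e B \<in> \<F>" using indep_insert_iff[OF B(1) e(1) eB] B e by simp
  then obtain C where C: "C \<in> \<F>" "insert e B \<subseteq> C" "C \<subseteq> E" "card C = r E"
    using extend_basis[of "insert e B" E] indep_subset by blast
  have i: "C - {e} \<in> \<F>" using C(1) by (rule indep_mono) auto
  define H where "H = cl (C - {e})"
  have sub: "C - {e} \<subseteq> E" using C by auto
  have H: "H \<in> Fl" unfolding H_def using sub by (rule clos_in_flats)
  have "r H = card (C - {e})" unfolding H_def using rank_clos[OF sub] rank_indep[OF i] by simp
  then have rH: "r H + 1 = r E" using C card_Suc_Diff1[of C e] indep_finite by simp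
  have eH: "e \<notin> H"
    using indep_insert_iff[OF i e(1)] C by (auto simp: H_def insert_absorb)
  have YH: "Y \<subseteq> H" unfolding H_def B(2)[symmetric] using C eB by (intro clos_mono) auto
  have iE: "insert e Y \<subseteq> E" using flats_subset[OF Y] e by auto
  have Y': "cl (insert e Y) \<in> Fl" "insert e Y \<subseteq> cl (insert e Y)"
    using clos_in_flats[OF iE] subset_clos[OF iE] by auto
  have "H \<inter> cl (insert e Y) \<subset> cl (insert e Y)" using eH Y' by auto
  then have "r (H \<inter> cl (insert e Y)) < r (cl (insert e Y))"
    using Int_flat H Y' by (intro flat_rank_less) auto
  also have "\<dots> = r Y + 1" using rank_clos[OF iE] flat_insert_rank Y e by simp
  finally have "Y = H \<inter> cl (insert e Y)"
    using YH Y' Int_flat H Y by (intro flat_eqI) auto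
  then show thesis using that H rH by auto
qed

text \<open>Submodularity gives one inequality; the other goes by induction on the corank of
  \<open>Y\<close>. Enlarging \<open>Y\<close> by an element of \<open>X\<close> raises its rank by
  one and keeps the join with \<open>X\<close>, so the rank of the meet must be shown to grow by at
  most one.\<close>

lemma trivial_socle_imp_modular:
  assumes socle: "trivial_socle TYPE('k :: field_char_0)" and X: "X \<in> Fl" and Y: "Y \<in> Fl"
  shows "r X + r Y = r (X \<inter> Y) + r (cl (X \<union> Y))"
proof -
  have "r X + r Y \<le> r (X \<inter> Y) + r (cl (X \<union> Y))" using Y
  proof (induction "r E - r Y" arbitrary: Y rule: less_induct)
    case less
    show ?case
    proof (cases "X \<subseteq> Y")
      case True
      then show ?thesis using less.prems clos_flat by (simp add: Int_absorb2 Un_absorb1)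
    next
      case False
      then obtain e where e: "e \<in> X" "e \<notin> Y" by blast
      have eE: "e \<in> E" using e flats_subset X by blast
      obtain H where H: "H \<in> Fl" "r H + 1 = r E" "H \<inter> cl (insert e Y) = Y"
        using separating_hyperplane[OF less.prems eE e(2)] by blast
      define Y' where "Y' = cl (insert e Y)"
      have iE: "insert e Y \<subseteq> E" using flats_subset[OF less.prems] eE by auto
      have Y': "Y' \<in> Fl" unfolding Y'_def using clos_in_flats[OF iE] .
      have rY': "r Y' = r Y + 1"
        unfolding Y'_def using rank_clos[OF iE] flat_insert_rank less.prems eE e by simp
      have "r Y' \<le> r E" using flats_subset[OF Y'] by (rule rank_mono)
      then have "r X + r Y' \<le> r (X \<inter> Y') + r (cl (X \<union> Y'))"
        using less.hyps[OF _ Y'] rY' by simp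
      moreover have "cl (X \<union> Y') = cl (X \<union> Y)"
      proof -
        have "cl (Y' \<union> X) = cl (insert e Y \<union> X)"
          unfolding Y'_def using iE flats_subset[OF X] by (rule clos_Un_clos)
        moreover have "insert e Y \<union> X = X \<union> Y" using e by auto
        ultimately show ?thesis by (simp add: Un_commute)
      qed
      \<comment> \<open>\<open>H\<close> cuts \<open>Y'\<close> down to \<open>Y\<close> and meets
        every line, so passing from \<open>X \<inter> Y'\<close> to \<open>X \<inter> Y\<close>
        loses at most one rank.\<close>
      moreover have "r (X \<inter> Y') \<le> r (X \<inter> Y' \<inter> H) + 1"
        using line_meets_hyperplane[OF socle _ _ H(1,2)] H(1) Int_flat[OF X Y']
        by (rule hyperplane_section_rank)
      moreover have "X \<inter> Y' \<inter> H = X \<inter> Y" using H(3) unfolding Y'_def by blast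
      ultimately show ?thesis using rY' by simp
    qed
  qed
  moreover have "X \<union> Y \<subseteq> E" using flats_subset X Y by auto
  then have "r (cl (X \<union> Y)) = r (X \<union> Y)" by (rule rank_clos)
  ultimately show ?thesis using rank_submod[of X Y] by simp
qed

end

section \<open>The lattice of flats\<close>

context matroid
begin

abbreviation L where "L \<equiv> flat_lattice E \<F>"

lemma flat_lattice_simps [simp]:
  "carrier L = Fl" "le L = (\<subseteq>)" "eq L = (=)"
  by (simp_all add: flat_lattice_def)

lemma lless_flat_lattice [simp]: "X \<sqsubset>\<^bsub>L\<^esub> Y \<longleftrightarrow> X \<subset> Y"
  by (auto simp: lless_def)

text \<open>Serves both for binary joins and for joins of sets of atoms.\<close>

lemma least_Upper_flats:
  assumes A: "A \<subseteq> Fl"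
  shows "least L (cl (\<Union>A)) (Upper L A)"
proof (rule least_UpperI)
  have AE: "\<Union>A \<subseteq> E" using A flats_subset by blast
  then show "cl (\<Union>A) \<in> carrier L" using clos_in_flats by simp
  show "X \<sqsubseteq>\<^bsub>L\<^esub> cl (\<Union>A)" if "X \<in> A" for X using subset_clos[OF AE] that by auto
  show "cl (\<Union>A) \<sqsubseteq>\<^bsub>L\<^esub> Y" if "Y \<in> Upper L A" for Y
  proof -
    have "Y \<in> Fl" "\<Union>A \<subseteq> Y" using that A by (auto simp: Upper_def)
    then show ?thesis using clos_subset_flat by simp
  qed
qed (use A in simp)

lemma greatest_Lower_flats: "X \<in> Fl \<Longrightarrow> Y \<in> Fl \<Longrightarrow> greatest L (X \<inter> Y) (Lower L {X, Y})"
  unfolding greatest_def Lower_def using Int_flat by auto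

lemma partial_order_flats: "partial_order L"
  by unfold_locales auto

lemma lattice_flats: "lattice L"
proof -
  interpret partial_order L by (rule partial_order_flats)
  show ?thesis
  proof unfold_locales
    fix X Y assume "X \<in> carrier L" "Y \<in> carrier L"
    then show "\<exists>S. least L S (Upper L {X, Y})" "\<exists>S. greatest L S (Lower L {X, Y})"
      using least_Upper_flats[of "{X, Y}"] greatest_Lower_flats[of X Y] by auto
  qed
qed

lemma join_flats: "X \<in> Fl \<Longrightarrow> Y \<in> Fl \<Longrightarrow> X \<squnion>\<^bsub>L\<^esub> Y = cl (X \<union> Y)"
proof -
  assume "X \<in> Fl" "Y \<in> Fl"
  then have *: "least L (cl (X \<union> Y)) (Upper L {X, Y})" using least_Upper_flats[of "{X, Y}"] by simp
  show ?thesis unfolding join_def sup_def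
    by (rule some_equality, rule *) (rule partial_order.least_unique[OF partial_order_flats _ *])
qed

lemma meet_flats: "X \<in> Fl \<Longrightarrow> Y \<in> Fl \<Longrightarrow> X \<sqinter>\<^bsub>L\<^esub> Y = X \<inter> Y"
proof -
  assume "X \<in> Fl" "Y \<in> Fl"
  then have *: "greatest L (X \<inter> Y) (Lower L {X, Y})" by (rule greatest_Lower_flats)
  show ?thesis unfolding meet_def inf_def
    by (rule some_equality, rule *) (rule partial_order.greatest_unique[OF partial_order_flats _ *])
qed

lemma bottom_flats: "\<bottom>\<^bsub>L\<^esub> = cl {}"
proof -
  have *: "least L (cl {}) (carrier L)"
    using clos_in_flats[of "{}"] clos_subset_flat[of "{}"] by (simp add: least_def)
  show ?thesis unfolding bottom_def
    by (rule some_equality, rule *) (rule partial_order.least_unique[OF partial_order_flats _ *])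
qed

text \<open>\<open>X\<close> and one element of \<open>Y\<close> outside it span a flat between the
  two, which must be \<open>Y\<close>. Conversely rank is strictly monotone on flats, so a gap of
  one leaves no room.\<close>

lemma covers_flats:
  "covers L Y X \<longleftrightarrow> X \<in> Fl \<and> Y \<in> Fl \<and> X \<subseteq> Y \<and> r Y = r X + 1"
proof
  assume cov: "covers L Y X"
  then have XY: "X \<in> Fl" "Y \<in> Fl" "X \<subset> Y" and no: "\<And>Z. Z \<in> Fl \<Longrightarrow> X \<subset> Z \<Longrightarrow> \<not> Z \<subset> Y"
    by (auto simp: covers_def)
  obtain e where e: "e \<in> Y" "e \<notin> X" using XY by blast
  have iE: "insert e X \<subseteq> E" using XY flats_subset e by blast
  have "X \<subset> cl (insert e X)" using subset_clos[OF iE] e by auto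
  moreover have "cl (insert e X) \<subseteq> Y" using XY e by (intro clos_subset_flat) auto
  ultimately have "Y = cl (insert e X)" using no[OF clos_in_flats[OF iE]] by blast
  then show "X \<in> Fl \<and> Y \<in> Fl \<and> X \<subseteq> Y \<and> r Y = r X + 1"
    using XY rank_clos[OF iE] flat_insert_rank[of X e] e iE by auto
next
  assume XY: "X \<in> Fl \<and> Y \<in> Fl \<and> X \<subseteq> Y \<and> r Y = r X + 1"
  have "\<not> Z \<subset> Y" if "Z \<in> Fl" "X \<subset> Z" for Z
    using flat_rank_less[of X Z] flat_rank_less[of Z Y] XY that by auto
  then show "covers L Y X" using XY by (auto simp: covers_def)
qed

text \<open>A flat is the join of the closures of the single elements of a basis.\<close>

lemma atomic_flats: "atomic L"
  unfolding atomic_def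
proof
  fix X assume "X \<in> carrier L"
  then have X: "X \<in> Fl" by simp
  obtain B where B: "B \<in> \<F>" "cl B = X" using flat_basis X by blast
  define A where "A = (\<lambda>e. cl {e}) ` B"
  have BE: "B \<subseteq> E" using B indep_subset by blast
  have atoms: "A \<subseteq> atoms L"
  proof
    fix a assume "a \<in> A"
    then obtain e where e: "e \<in> B" "a = cl {e}" by (auto simp: A_def)
    have i: "{e} \<in> \<F>" using B(1) by (rule indep_mono) (use e in auto)
    have "r a = 1" using e rank_clos[of "{e}"] rank_indep[OF i] BE by auto
    moreover have "r (cl {}) = 0" by (simp add: rank_clos)
    ultimately show "a \<in> atoms L"
      using e BE clos_in_flats[of "{}"] clos_in_flats[of "{e}"] clos_mono[of "{}" "{e}"]
      by (auto simp: atoms_def covers_flats bottom_flats)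
  qed
  then have AF: "A \<subseteq> Fl" by (auto simp: atoms_def covers_flats)
  have "B \<subseteq> \<Union>A" unfolding A_def using subset_clos[of "{_}"] BE by fast
  moreover have "\<Union>A \<subseteq> X" unfolding A_def B(2)[symmetric] using clos_mono[of "{_}" B] by fast
  ultimately have "cl (\<Union>A) = X"
    using clos_mono[of B "\<Union>A"] clos_subset_flat[of "\<Union>A", OF _ X] B(2) by simp
  then show "\<exists>A\<subseteq>atoms L. least L X (Upper L A)" using least_Upper_flats[OF AF] atoms by auto
qed

text \<open>Every flat lattice is graded, atomic and semimodular, the last by submodularity of rank;
  only the modular equality remains.\<close>

lemma modular_geometric_flats_iff:
  "modular_geometric_lattice L r
     \<longleftrightarrow> (\<forall>X\<in>Fl. \<forall>Y\<in>Fl. r X + r Y = r (X \<inter> Y) + r (cl (X \<union> Y)))"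
proof -
  have "finite_graded_lattice L r"
    unfolding finite_graded_lattice_def
    using lattice_flats finite_flats ground_flat covers_flats by (auto simp: bottom_flats rank_clos)
  moreover have "r (X \<inter> Y) + r (cl (X \<union> Y)) \<le> r X + r Y" if "X \<in> Fl" "Y \<in> Fl" for X Y
  proof -
    have "r (cl (X \<union> Y)) = r (X \<union> Y)" using flats_subset that by (intro rank_clos) auto
    then show ?thesis using rank_submod[of X Y] by simp
  qed
  then have "semimodular L r" by (simp add: semimodular_def join_flats meet_flats)
  moreover have "modular L r \<longleftrightarrow> (\<forall>X\<in>Fl. \<forall>Y\<in>Fl. r X + r Y = r (X \<inter> Y) + r (cl (X \<union> Y)))"
    by (simp add: modular_def join_flats meet_flats)
  ultimately show ?thesis
    using atomic_flats by (simp add: modular_geometric_lattice_def geometric_lattice_def)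
qed

theorem modular_geometric_iff_trivial_socle:
  "modular_geometric_lattice L r \<longleftrightarrow> trivial_socle TYPE('k :: field_char_0)"
proof
  assume "modular_geometric_lattice L r"
  then show "trivial_socle TYPE('k)"
    unfolding trivial_socle_def modular_geometric_flats_iff
    using modular_imp_trivial_socle by blast
next
  assume "trivial_socle TYPE('k)"
  then show "modular_geometric_lattice L r"
    unfolding modular_geometric_flats_iff using trivial_socle_imp_modular by blast
qed

end

section \<open>Polynomials\<close>

abbreviation lookup where "lookup \<equiv> Poly_Mapping.lookup"
abbreviation single where "single \<equiv> Poly_Mapping.single"
abbreviation keys where "keys \<equiv> Poly_Mapping.keys"

lemma lookup_single_mult:
  "lookup (single t a * p) k = a * (\<Sum>q. lookup p q when k = t + q)"
  for p :: "('a :: comm_monoid_add) \<Rightarrow>\<^sub>0 ('k :: comm_ring_1)"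
proof -
  have "lookup (single t a * p) k = (\<Sum>l. (a when t = l) * (\<Sum>q. lookup p q when k = l + q))"
    by (simp add: lookup_mult lookup_single)
  also have "\<dots> = (\<Sum>l. (a * (\<Sum>q. lookup p q when k = t + q)) when t = l)"
    by (rule Sum_any.cong) (simp add: when_def)
  finally show ?thesis by simp
qed

lemma lookup_single_mult_add:
  "lookup (single t a * p) (t + m) = a * lookup p m"
  for p :: "('a :: cancel_comm_monoid_add) \<Rightarrow>\<^sub>0 ('k :: comm_ring_1)"
  by (simp add: lookup_single_mult)

lemma lookup_single_mult_eq_0:
  "(\<And>m. k \<noteq> t + m) \<Longrightarrow> lookup (single t a * p) k = 0"
  for p :: "('a :: cancel_comm_monoid_add) \<Rightarrow>\<^sub>0 ('k :: comm_ring_1)"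
  by (simp add: lookup_single_mult)

text \<open>Exponents are natural numbers, so the zero exponent splits only as
  \<open>0 + 0\<close>.\<close>

lemma lookup_mult_zero:
  "lookup (p * q) 0 = lookup p 0 * lookup q 0"
  for p q :: "('a \<Rightarrow>\<^sub>0 nat) \<Rightarrow>\<^sub>0 ('k :: comm_ring_1)"
proof -
  have "0 = l + k \<longleftrightarrow> l = 0 \<and> k = 0" for l k :: "'a \<Rightarrow>\<^sub>0 nat"
    by (auto simp: poly_mapping_eq_iff fun_eq_iff lookup_add)
  then have "lookup (p * q) 0 = (\<Sum>l. lookup p l * (\<Sum>k. (lookup q k when l = 0) when k = 0))"
    unfolding lookup_mult by (intro Sum_any.cong arg_cong2[of _ _ _ _ "(*)"]) (auto simp: when_def)
  also have "\<dots> = (\<Sum>l. (lookup p l * lookup q l) when l = 0)"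
    by (intro Sum_any.cong) (auto simp: when_def)
  finally show ?thesis by simp
qed

lemma sum_single: "p = (\<Sum>m\<in>keys p. single m (lookup p m))"
proof (rule poly_mapping_eqI)
  fix k
  have "lookup (\<Sum>m\<in>keys p. single m (lookup p m)) k = (\<Sum>m\<in>keys p. if m = k then lookup p m else 0)"
    by (simp add: lookup_sum lookup_single when_def)
  also have "\<dots> = lookup p k" by (simp add: in_keys_iff)
  finally show "lookup p k = lookup (\<Sum>m\<in>keys p. single m (lookup p m)) k" by simp
qed

section \<open>Squarefree monomials\<close>

definition sqfree :: "'e set \<Rightarrow> 'e \<Rightarrow>\<^sub>0 nat" where
  "sqfree A = (\<Sum>e\<in>A. single e 1)"

lemma lookup_sqfree: "finite A \<Longrightarrow> lookup (sqfree A) e = (if e \<in> A then 1 else 0)"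
  by (simp add: sqfree_def lookup_sum lookup_single when_def)

lemma keys_sqfree: "finite A \<Longrightarrow> keys (sqfree A) = A"
  by (auto simp: in_keys_iff lookup_sqfree split: if_splits)

lemma sqfree_eq_iff: "finite A \<Longrightarrow> finite B \<Longrightarrow> sqfree A = sqfree B \<longleftrightarrow> A = B"
  by (metis keys_sqfree)

lemma sqfree_insert: "finite A \<Longrightarrow> e \<notin> A \<Longrightarrow> sqfree (insert e A) = single e 1 + sqfree A"
  by (simp add: sqfree_def)

lemma X_set_eq: "finite A \<Longrightarrow> X_set A = single (sqfree A) 1"
proof (induction A rule: finite_induct)
  case empty
  then show ?case by (simp add: X_set_def sqfree_def)
next
  case (insert e A)
  have "X_set (insert e A) = X_var e * (X_set A :: ('a, 'b) mpoly)"
    using insert by (simp add: X_set_def)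
  then show ?case using insert by (simp add: X_var_def mult_single sqfree_insert)
qed

lemma X_var_power: "X_var e ^ 2 = single (single e 2) 1"
  unfolding X_var_def power2_eq_square mult_single by (simp add: single_add[symmetric] numeral_2_eq_2)

lemma split_monomial:
  fixes m :: "'e \<Rightarrow>\<^sub>0 nat"
  assumes "n \<le> lookup m e"
  shows "m = single e n + (m - single e n)" "keys (m - single e n) \<subseteq> keys m"
  using assms by (auto simp: poly_mapping_eq_iff fun_eq_iff lookup_add lookup_minus lookup_single when_def in_keys_iff)

section \<open>The polynomial ring on \<open>E\<close> and its induction principles\<close>

lemma mpoly_ring_simps [simp]:
  "\<zero>\<^bsub>mpoly_ring E\<^esub> = 0" "\<one>\<^bsub>mpoly_ring E\<^esub> = 1"
  "p \<oplus>\<^bsub>mpoly_ring E\<^esub> q = p + q" "p \<otimes>\<^bsub>mpoly_ring E\<^esub> q = p * q"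
  by (simp_all add: mpoly_ring_def)

lemma mpoly_ring_carrier: "p \<in> carrier (mpoly_ring E) \<longleftrightarrow> (\<forall>m\<in>keys p. keys m \<subseteq> E)"
  by (simp add: mpoly_ring_def)

lemma mpoly_carrier_add:
  "p \<in> carrier (mpoly_ring E) \<Longrightarrow> q \<in> carrier (mpoly_ring E) \<Longrightarrow> p + q \<in> carrier (mpoly_ring E)"
  using keys_add[of p q] unfolding mpoly_ring_carrier by blast

lemma mpoly_carrier_mult:
  assumes "p \<in> carrier (mpoly_ring E)" "q \<in> carrier (mpoly_ring E)"
  shows "p * q \<in> carrier (mpoly_ring E)"
  unfolding mpoly_ring_carrier
proof
  fix m assume "m \<in> keys (p * q)"
  then obtain a b where "m = a + b" "a \<in> keys p" "b \<in> keys q" using keys_mult[of p q] by blast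
  then show "keys m \<subseteq> E" using keys_add[of a b] assms unfolding mpoly_ring_carrier by blast
qed

lemma mpoly_carrier_uminus: "p \<in> carrier (mpoly_ring E) \<Longrightarrow> - p \<in> carrier (mpoly_ring E)"
  unfolding mpoly_ring_carrier by (simp add: in_keys_iff)

lemma mpoly_carrier_single: "keys m \<subseteq> E \<Longrightarrow> single m a \<in> carrier (mpoly_ring E)"
  by (simp add: mpoly_ring_carrier)

lemma mpoly_carrier_0: "0 \<in> carrier (mpoly_ring E)"
  and mpoly_carrier_1: "1 \<in> carrier (mpoly_ring E)"
  by (simp_all add: mpoly_ring_carrier)

lemma mpoly_carrier_X: "e \<in> E \<Longrightarrow> X_var e \<in> carrier (mpoly_ring E)"
  unfolding X_var_def by (rule mpoly_carrier_single) simp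

lemma cring_mpoly_ring: "cring (mpoly_ring E)"
proof (rule cringI)
  show "abelian_group (mpoly_ring E)"
  proof (rule abelian_groupI)
    fix p assume "p \<in> carrier (mpoly_ring E)"
    then show "\<exists>q\<in>carrier (mpoly_ring E). q \<oplus>\<^bsub>mpoly_ring E\<^esub> p = \<zero>\<^bsub>mpoly_ring E\<^esub>"
      using mpoly_carrier_uminus[of p] by (intro bexI[of _ "- p"]) auto
  qed (auto simp: algebra_simps mpoly_carrier_add mpoly_carrier_0)
  show "comm_monoid (mpoly_ring E)"
    by (rule comm_monoidI) (auto simp: algebra_simps mpoly_carrier_mult mpoly_carrier_1)
qed (auto simp: algebra_simps)

lemma mpoly_induct [consumes 1, case_names zero single add]:
  assumes "p \<in> carrier (mpoly_ring E)" and "P 0"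
    and "\<And>m a. keys m \<subseteq> E \<Longrightarrow> (m = 0 \<Longrightarrow> a = lookup p 0) \<Longrightarrow> P (single m a)"
    and "\<And>p q. P p \<Longrightarrow> P q \<Longrightarrow> P (p + q)"
  shows "P p"
proof -
  have "P (\<Sum>m\<in>M. single m (lookup p m))" if "M \<subseteq> keys p" for M
    using finite_subset[OF that finite_keys] that
    by (induction M rule: finite_induct) (use assms in \<open>auto simp: mpoly_ring_carrier\<close>)
  from this[of "keys p"] show ?thesis using sum_single[of p] by simp
qed

text \<open>Every monomial other than the constant one has a variable as a factor.\<close>

lemma augmentation_induct [consumes 2, case_names zero var add]:
  fixes p :: "('e, 'k :: comm_ring_1) mpoly"
  assumes p: "p \<in> carrier (mpoly_ring E)" "lookup p 0 = 0" and P0: "P 0"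
    and PX: "\<And>e q. e \<in> E \<Longrightarrow> q \<in> carrier (mpoly_ring E) \<Longrightarrow> P (X_var e * q)"
    and Padd: "\<And>p q. P p \<Longrightarrow> P q \<Longrightarrow> P (p + q)"
  shows "P p"
  using p(1)
proof (induction p rule: mpoly_induct)
  case (single m a)
  show ?case
  proof (cases "m = 0")
    case True
    then show ?thesis using single p P0 by simp
  next
    case False
    then obtain e where e: "lookup m e \<noteq> 0" by (auto simp: poly_mapping_eq_iff fun_eq_iff)
    then have "1 \<le> lookup m e" by simp
    note m = split_monomial[OF this]
    have "single m a = X_var e * single (m - single e 1) a"
      using m(1) by (simp add: X_var_def mult_single)
    moreover have "e \<in> E" using single(1) e by (auto simp: in_keys_iff)
    moreover have "keys (m - single e 1) \<subseteq> E" using m(2) single(1) by (rule order_trans)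
    ultimately show ?thesis using PX[OF _ mpoly_carrier_single] by simp
  qed
qed (use P0 Padd in auto)

section \<open>The coordinates of a polynomial modulo the matroid ideal\<close>

context matroid
begin

abbreviation Q :: "('e, 'k :: comm_ring_1) mpoly ring" where "Q \<equiv> mpoly_ring E"
abbreviation J :: "('e, 'k :: comm_ring_1) mpoly set" where "J \<equiv> matroid_ideal E \<F>"

text \<open>The coordinate at \<open>y\<^sub>F\<close> modulo the ideal: all bases of
  \<open>F\<close> have the same class, while monomials with a square or with dependent support
  vanish.\<close>

definition phi :: "('e, 'k :: comm_ring_1) mpoly \<Rightarrow> 'e set \<Rightarrow> 'k" where
  "phi p F = (\<Sum>A | A \<in> \<F> \<and> cl A = F. lookup p (sqfree A))"

lemma phi_add: "phi (p + q) F = phi p F + phi q F"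
  by (simp add: phi_def lookup_add sum.distrib)

lemma phi_0 [simp]: "phi 0 F = 0"
  by (simp add: phi_def)

lemma phi_diff: "phi (p - q) F = phi p F - phi q F"
  by (simp add: phi_def lookup_minus sum_subtractf)

lemma phi_scale: "phi (single 0 a * p) F = a * phi p F"
  using lookup_single_mult_add[of 0 a p] by (simp add: phi_def sum_distrib_left)

lemma phi_not_flat: "F \<notin> Fl \<Longrightarrow> phi p F = 0"
  using clos_in_flats indep_subset unfolding phi_def by (intro sum.neutral) blast

text \<open>Squarefree monomials of the product that contain \<open>e\<close> arise from the ones
  without \<open>e\<close>; deleting \<open>e\<close> and grouping by closure gives
  \<open>act\<close>. In particular the coordinates of the product depend only on those of
  \<open>p\<close>.\<close>

lemma phi_X_var:
  assumes e: "e \<in> E"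
  shows "phi (X_var e * p) G = act e (phi p) G"
proof -
  let ?S = "{A. A \<in> \<F> \<and> e \<notin> cl A \<and> cl (insert e A) = G}"
  have fin: "finite {A. A \<in> \<F> \<and> P A}" for P using finite_indep by simp
  have sup: "e \<notin> A" if "A \<in> ?S" for A using that subset_clos indep_subset by blast
  \<comment> \<open>A monomial not containing \<open>e\<close> has coefficient 0 in a multiple of
    \<open>X_var e\<close>.\<close>
  have "phi (X_var e * p) G = (\<Sum>A | A \<in> \<F> \<and> cl A = G \<and> e \<in> A. lookup (X_var e * p) (sqfree A))"
    unfolding phi_def
  proof (intro sum.mono_neutral_right fin subsetI ballI)
    fix A assume "A \<in> {A \<in> \<F>. cl A = G} - {A \<in> \<F>. cl A = G \<and> e \<in> A}"
    then have A: "A \<in> \<F>" "e \<notin> A" by auto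
    have "sqfree A \<noteq> single e 1 + m" for m
    proof
      assume "sqfree A = single e 1 + m"
      then have "lookup (sqfree A) e = lookup (single e 1 + m) e" by simp
      then show False using A indep_finite by (simp add: lookup_sqfree lookup_add)
    qed
    then show "lookup (X_var e * p) (sqfree A) = 0"
      unfolding X_var_def by (rule lookup_single_mult_eq_0)
  qed auto
  also have "\<dots> = (\<Sum>A\<in>?S. lookup (X_var e * p) (sqfree (insert e A)))"
  proof (rule sum.reindex_bij_witness[of _ "insert e" "\<lambda>A. A - {e}"])
    fix A assume A: "A \<in> {A. A \<in> \<F> \<and> cl A = G \<and> e \<in> A}"
    then show eq: "insert e (A - {e}) = A" by blast
    show "A - {e} \<in> ?S" using A indep_insert_clos_iff[OF e, of "A - {e}"] eq by simp
    show "lookup (X_var e * p) (sqfree (insert e (A - {e}))) = lookup (X_var e * p) (sqfree A)"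
      unfolding eq by (rule refl)
  next
    fix A assume A: "A \<in> ?S"
    then show "insert e A - {e} = A" using sup[of A] by blast
    show "insert e A \<in> {A. A \<in> \<F> \<and> cl A = G \<and> e \<in> A}" using A indep_insert_clos_iff[OF e, of A] by blast
  qed
  also have "\<dots> = (\<Sum>A\<in>?S. lookup p (sqfree A))"
  proof (rule sum.cong)
    fix A assume A: "A \<in> ?S"
    then have "finite A" using indep_finite by blast
    then have "sqfree (insert e A) = single e 1 + sqfree A" using sup[OF A] by (rule sqfree_insert)
    then show "lookup (X_var e * p) (sqfree (insert e A)) = lookup p (sqfree A)"
      by (simp only: X_var_def lookup_single_mult_add) simp
  qed simp
  \<comment> \<open>Whether \<open>A\<close> occurs depends only on \<open>cl A\<close>, since
    \<open>cl (insert e A)\<close> does; hence full fibres of the closure are summed.\<close>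
  also have "\<dots> = (\<Sum>F | F \<in> Fl \<and> e \<notin> F \<and> cl (insert e F) = G. \<Sum>A | A \<in> ?S \<and> cl A = F. lookup p (sqfree A))"
  proof (rule sum.group[symmetric])
    show "cl ` ?S \<subseteq> {F \<in> Fl. e \<notin> F \<and> cl (insert e F) = G}"
    proof
      fix F assume "F \<in> cl ` ?S"
      then obtain A where A: "A \<in> ?S" "F = cl A" by blast
      then have "A \<subseteq> E" using indep_subset by blast
      then show "F \<in> {F \<in> Fl. e \<notin> F \<and> cl (insert e F) = G}"
        using A clos_in_flats[of A] clos_insert_clos[of A e] e by simp
    qed
  qed (use fin finite_flats in auto)
  also have "\<dots> = act e (phi p) G"
    unfolding act_def phi_def
  proof (intro sum.cong refl)
    fix F assume F: "F \<in> {F \<in> Fl. e \<notin> F \<and> cl (insert e F) = G}"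
    have "cl (insert e A) = G" if "A \<in> \<F>" "cl A = F" for A
      using that F clos_insert_clos[of A e] indep_subset[of A] e by simp
    then show "{A. A \<in> ?S \<and> cl A = F} = {A \<in> \<F>. cl A = F}" using F by blast
  qed
  finally show ?thesis .
qed

lemma phi_single_not_indep:
  assumes "\<And>A. A \<in> \<F> \<Longrightarrow> m \<noteq> sqfree A"
  shows "phi (single m a) F = 0"
  using assms unfolding phi_def by (intro sum.neutral) (auto simp: lookup_single when_def)

lemma phi_single_indep:
  assumes "A \<in> \<F>"
  shows "phi (single (sqfree A) a) F = (if cl A = F then a else 0)"
proof -
  have fin: "finite {B \<in> \<F>. cl B = F}" using finite_indep by simp
  have "phi (single (sqfree A) a) F = (\<Sum>B | B \<in> \<F> \<and> cl B = F. if B = A then a else 0)"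
    unfolding phi_def using assms indep_finite
    by (intro sum.cong) (auto simp: lookup_single when_def sqfree_eq_iff)
  then show ?thesis using assms fin by simp
qed

text \<open>An independent set spanning \<open>cl {}\<close> has rank 0 and is empty. Thus the
  constant term is one of the coordinates.\<close>

lemma phi_bottom: "phi p (cl {}) = lookup p 0"
proof -
  have "A = {}" if "A \<in> \<F>" "cl A = cl {}" for A
  proof -
    have "card A = r {}"
      using that rank_clos[of A] rank_clos[of "{}"] rank_indep[of A] indep_subset[of A] by simp
    then show ?thesis using that indep_finite by simp
  qed
  then have "{A. A \<in> \<F> \<and> cl A = cl {}} = {{}}" using indep_empty by auto
  then show ?thesis by (simp add: phi_def sqfree_def)
qed

text \<open>By \<open>phi_X_var\<close>, multiplication by a variable preserves vanishing
  coordinates; a monomial factor is peeled off one variable at a time, by induction on its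
  degree.\<close>

lemma phi_mult_eq_0:
  assumes q: "q \<in> carrier Q" and p: "\<And>F. phi p F = 0"
  shows "phi (q * p) F = 0"
  using q
proof (induction q rule: mpoly_induct)
  case (single m a)
  have "single m a * p = single 0 a * (single m 1 * p)"
    by (simp add: mult_single mult.assoc[symmetric])
  moreover have "phi (single m 1 * p) F = 0"
    using single(1)
  proof (induction "sum (lookup m) (keys m)" arbitrary: m F rule: less_induct)
    case less
    show ?case
    proof (cases "keys m = {}")
      case True
      then have "m = 0" by simp
      then show ?thesis using p by simp
    next
      case False
      then obtain e where e: "e \<in> keys m" by blast
      then have "1 \<le> lookup m e" by (simp add: in_keys_iff)
      note m = split_monomial[OF this]
      let ?m = "m - single e 1"
      have "sum (lookup ?m) (keys ?m) \<le> sum (lookup ?m) (keys m)"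
        using m(2) by (intro sum_mono2) auto
      also have "\<dots> < sum (lookup m) (keys m)"
      proof (rule sum_strict_mono_ex1)
        show "\<forall>x\<in>keys m. lookup ?m x \<le> lookup m x" by (simp add: lookup_minus)
        show "\<exists>x\<in>keys m. lookup ?m x < lookup m x"
          using e by (intro bexI[of _ e]) (simp_all add: lookup_minus in_keys_iff)
      qed simp
      finally have IH: "phi (single ?m 1 * p) F = 0" for F
        using less.hyps[of ?m] order_trans[OF m(2) less.prems] by blast
      have "single m 1 * p = X_var e * (single ?m 1 * p)"
        unfolding X_var_def mult.assoc[symmetric] mult_single m(1)[symmetric] by simp
      moreover have "e \<in> E" using e less.prems by blast
      ultimately show ?thesis using phi_X_var[of e "single ?m 1 * p"] IH by (simp add: act_def)
    qed
  qed
  ultimately show ?case by (simp add: phi_scale)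
qed (auto simp: algebra_simps phi_add)

end

text \<open>Negatives come from multiplication by \<open>\<ominus> \<one>\<close>.\<close>

lemma (in cring) ideal_if_closed:
  assumes "I \<subseteq> carrier R" "\<zero> \<in> I" "\<And>a b. a \<in> I \<Longrightarrow> b \<in> I \<Longrightarrow> a \<oplus> b \<in> I"
    and mult: "\<And>a x. a \<in> I \<Longrightarrow> x \<in> carrier R \<Longrightarrow> x \<otimes> a \<in> I"
  shows "ideal I R"
proof (rule idealI[OF ring_axioms])
  show "subgroup I (add_monoid R)"
  proof
    fix x assume x: "x \<in> I"
    then have "\<ominus> x = (\<ominus> \<one>) \<otimes> x" using assms(1) l_minus[of \<one> x] by auto
    then show "inv\<^bsub>add_monoid R\<^esub> x \<in> I" using mult[OF x, of "\<ominus> \<one>"] by (simp add: a_inv_def)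
  qed (use assms in auto)
next
  fix a x assume "a \<in> I" "x \<in> carrier R"
  then show "x \<otimes> a \<in> I" "a \<otimes> x \<in> I" using mult[of a x] assms(1) m_comm[of a x] by auto
qed

context matroid
begin

section \<open>The ideal lies in the kernel of the coordinates\<close>

lemma Lambda_subset: "Lambda E \<F> \<subseteq> carrier Q"
proof -
  have X: "X_set S \<in> carrier Q" if "S \<subseteq> E" for S
    using that finite_subset[OF that finite_ground] by (simp add: X_set_eq keys_sqfree mpoly_carrier_single)
  have "X_var e ^ 2 \<in> carrier Q" if "e \<in> E" for e
    using that mpoly_carrier_mult[OF mpoly_carrier_X mpoly_carrier_X] by (simp add: power2_eq_square)
  moreover have "X_set A - X_set A' \<in> carrier Q" if "A \<in> \<F>" "A' \<in> \<F>" for A A'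
    using mpoly_carrier_add[OF X mpoly_carrier_uminus[OF X], of A A'] that indep_subset by simp
  ultimately show ?thesis using X unfolding Lambda_def by blast
qed

lemma ideal_J: "ideal J Q"
  unfolding matroid_ideal_def
  by (rule ring.genideal_ideal[OF cring.axioms(1)[OF cring_mpoly_ring] Lambda_subset])

lemma Lambda_in_J: "p \<in> Lambda E \<F> \<Longrightarrow> p \<in> J"
  unfolding matroid_ideal_def
  using ring.genideal_self[OF cring.axioms(1)[OF cring_mpoly_ring] Lambda_subset] by blast

lemma J_add: "p \<in> J \<Longrightarrow> q \<in> J \<Longrightarrow> p + q \<in> J"
  using additive_subgroup.a_closed[OF ideal.axioms(1)[OF ideal_J], of p q] by simp

lemma J_mult: "p \<in> J \<Longrightarrow> q \<in> carrier Q \<Longrightarrow> q * p \<in> J"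
  using ideal.I_l_closed[OF ideal_J, of p q] by simp

lemma J_0: "0 \<in> J"
  using additive_subgroup.zero_closed[OF ideal.axioms(1)[OF ideal_J]] by simp

text \<open>The common kernel of the coordinates is an ideal. Squares and dependent monomials lie in
  it because no independent set has their exponents, and the two terms of a difference generator
  contribute to the same coordinate and cancel.\<close>

lemma phi_J:
  fixes p :: "('e, 'k :: comm_ring_1) mpoly"
  assumes "p \<in> J"
  shows "phi p F = 0"
proof -
  let ?K = "{p :: ('e, 'k) mpoly. p \<in> carrier Q \<and> (\<forall>F. phi p F = 0)}"
  interpret cring "Q :: ('e, 'k) mpoly ring" by (rule cring_mpoly_ring)
  have "ideal ?K Q"
    by (rule ideal_if_closed) (auto simp: mpoly_carrier_add mpoly_carrier_0 mpoly_carrier_mult phi_add phi_mult_eq_0)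
  moreover have "Lambda E \<F> \<subseteq> ?K"
  proof
    fix p :: "('e, 'k) mpoly" assume p: "p \<in> Lambda E \<F>"
    have "phi p F = 0" for F
    proof -
      consider e where "e \<in> E" "p = X_var e ^ 2" | S where "S \<subseteq> E" "S \<notin> \<F>" "p = X_set S"
        | A A' where "A \<in> \<F>" "A' \<in> \<F>" "cl A = cl A'" "p = X_set A - X_set A'"
        using p unfolding Lambda_def by blast
      then show ?thesis
      proof cases
        case 1
        have "single e 2 \<noteq> sqfree A" if "A \<in> \<F>" for A
        proof
          assume "single e 2 = sqfree A"
          then have "lookup (single e (2::nat)) e = lookup (sqfree A) e" by simp
          then show False using lookup_sqfree[of A e] indep_finite[OF that] by (simp split: if_splits)
        qed
        then show ?thesis unfolding 1 X_var_power by (rule phi_single_not_indep)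
      next
        case 2
        have fin: "finite S" using 2 finite_ground finite_subset by blast
        have "sqfree S \<noteq> sqfree A" if "A \<in> \<F>" for A
          using that 2 fin sqfree_eq_iff[of S A] indep_finite by auto
        then show ?thesis unfolding 2 X_set_eq[OF fin] by (rule phi_single_not_indep)
      next
        case 3
        then show ?thesis using indep_finite by (simp add: X_set_eq phi_diff phi_single_indep)
      qed
    qed
    then show "p \<in> ?K" using Lambda_subset p by blast
  qed
  ultimately have "J \<subseteq> ?K" unfolding matroid_ideal_def by (rule genideal_minimal)
  then show ?thesis using assms by blast
qed

section \<open>Normal forms modulo the ideal\<close>

definition basis_of :: "'e set \<Rightarrow> 'e set" where
  "basis_of F = (SOME B. B \<in> \<F> \<and> cl B = F)"

lemma basis_of: "F \<in> Fl \<Longrightarrow> basis_of F \<in> \<F>" "F \<in> Fl \<Longrightarrow> cl (basis_of F) = F"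
  using someI_ex[of "\<lambda>B. B \<in> \<F> \<and> cl B = F"] flat_basis[of F] by (auto simp: basis_of_def)

text \<open>A section of \<open>phi\<close>, giving the normal form with prescribed
  coordinates.\<close>

definition psi :: "('e set \<Rightarrow> 'k :: comm_ring_1) \<Rightarrow> ('e, 'k) mpoly" where
  "psi c = (\<Sum>F\<in>Fl. single (sqfree (basis_of F)) (c F))"

lemma psi_carrier: "psi c \<in> carrier Q"
  unfolding mpoly_ring_carrier
proof
  fix m assume "m \<in> keys (psi c)"
  then obtain F where F: "F \<in> Fl" "m \<in> keys (single (sqfree (basis_of F)) (c F))"
    unfolding psi_def using keys_sum[of "\<lambda>F. single (sqfree (basis_of F)) (c F)" Fl] by blast
  then have "m = sqfree (basis_of F)" by (auto split: if_splits)
  then show "keys m \<subseteq> E" using basis_of(1)[OF F(1)] indep_finite indep_subset by (simp add: keys_sqfree)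
qed

lemma phi_psi: "F \<in> Fl \<Longrightarrow> phi (psi c) F = c F"
proof -
  have sum: "phi (\<Sum>F\<in>S. f F) G = (\<Sum>F\<in>S. phi (f F) G)" if "finite S"
    for S and f :: "'e set \<Rightarrow> ('e, 'a) mpoly" and G
    using that by (induction S rule: finite_induct) (auto simp: phi_add)
  assume F: "F \<in> Fl"
  have "phi (psi c) F = (\<Sum>G\<in>Fl. if G = F then c G else 0)"
    unfolding psi_def sum[OF finite_flats] using basis_of by (intro sum.cong) (auto simp: phi_single_indep)
  then show ?thesis using F finite_flats by simp
qed

text \<open>Checked on monomials: modulo the ideal each is 0, or the monomial of an independent set,
  which may be exchanged for the chosen basis of its closure.\<close>

lemma diff_psi_phi_in_J:
  fixes p :: "('e, 'k :: comm_ring_1) mpoly"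
  assumes "p \<in> carrier Q"
  shows "p - psi (phi p) \<in> J"
  using assms
proof (induction p rule: mpoly_induct)
  case zero
  then show ?case using J_0 by (simp add: psi_def)
next
  case (add p q)
  have "psi (phi (p + q)) = psi (phi p) + psi (phi q)"
    by (simp add: psi_def phi_add single_add sum.distrib)
  then show ?case using J_add[OF add] by (simp add: algebra_simps)
next
  case (single m a)
  have c: "single 0 a \<in> carrier Q" by (rule mpoly_carrier_single) simp
  have fin: "finite (keys m)" by simp
  show ?case
  proof (cases "\<exists>e. 2 \<le> lookup m e")
    case True
    then obtain e where e: "2 \<le> lookup m e" by blast
    note m = split_monomial[OF e]
    have eE: "e \<in> E" using single(1) e by (auto simp: in_keys_iff)
    have "X_var e ^ 2 \<in> J" using eE by (intro Lambda_in_J) (auto simp: Lambda_def)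
    then have "single (m - single e 2) a * X_var e ^ 2 \<in> J"
      using mpoly_carrier_single[of "m - single e 2" E a] m(2) single(1) by (intro J_mult) auto
    moreover have "single (m - single e 2) a * X_var e ^ 2 = single m a"
      unfolding X_var_power mult_single using m(1) by (simp add: add.commute)
    moreover have "m \<noteq> sqfree A" if "A \<in> \<F>" for A
      using e lookup_sqfree[of A e] indep_finite[OF that] by (auto split: if_splits)
    then have "phi (single m a) = (\<lambda>F. 0)" using phi_single_not_indep by blast
    then have "psi (phi (single m a)) = 0" by (simp add: psi_def)
    ultimately show ?thesis by simp
  next
    case False
    \<comment> \<open>All exponents are at most 1, so the monomial is determined by its
      support.\<close>
    have "lookup m e = lookup (sqfree (keys m)) e" for e
    proof -
      have "\<not> 2 \<le> lookup m e" using False by blast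
      then show ?thesis using lookup_sqfree[OF fin, of e] by (auto simp: in_keys_iff)
    qed
    then have "sqfree (keys m) = m" by (intro poly_mapping_eqI) simp
    then obtain S where S: "S \<subseteq> E" "finite S" "m = sqfree S" using single(1) fin by metis
    have mS: "single m a = single 0 a * X_set S" using S by (simp add: X_set_eq mult_single)
    show ?thesis
    proof (cases "S \<in> \<F>")
      case False
      then have "X_set S \<in> J" using S by (intro Lambda_in_J) (auto simp: Lambda_def)
      then have "single m a \<in> J" unfolding mS using c by (rule J_mult)
      moreover have "m \<noteq> sqfree A" if "A \<in> \<F>" for A
        using S False that sqfree_eq_iff[of S A] indep_finite by auto
      then have "phi (single m a) = (\<lambda>F. 0)" using phi_single_not_indep by blast
      then have "psi (phi (single m a)) = 0" by (simp add: psi_def)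
      ultimately show ?thesis by simp
    next
      case True
      have clS: "cl S \<in> Fl" using S clos_in_flats by blast
      let ?B = "basis_of (cl S)"
      have "X_set S - X_set ?B \<in> Lambda E \<F>"
        unfolding Lambda_def using True basis_of[OF clS]
        by (intro UnI2 CollectI exI[of _ S] exI[of _ ?B]) simp
      then have "X_set S - X_set ?B \<in> J" by (rule Lambda_in_J)
      then have "single 0 a * (X_set S - X_set ?B) \<in> J" using c by (rule J_mult)
      moreover have "psi (phi (single m a)) = single (sqfree ?B) a"
      proof -
        have "psi (phi (single m a)) = (\<Sum>F\<in>Fl. if F = cl S then single (sqfree (basis_of F)) a else 0)"
          unfolding psi_def S(3) phi_single_indep[OF True] by (rule sum.cong) auto
        then show ?thesis using clS finite_flats by simp
      qed
      moreover have "finite ?B" using basis_of(1)[OF clS] indep_finite by blast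
      ultimately show ?thesis unfolding mS by (simp add: X_set_eq mult_single algebra_simps)
    qed
  qed
qed

text \<open>If all coordinates vanish, the normal form of \<open>p\<close> is 0 and \<open>p\<close>
  is its own difference from it.\<close>

lemma J_iff: "p \<in> carrier Q \<Longrightarrow> p \<in> J \<longleftrightarrow> (\<forall>F. phi p F = 0)"
  using diff_psi_phi_in_J[of p] phi_J[of p] by (auto simp: psi_def)

end

section \<open>The quotient algebra\<close>

text \<open>Induction on the coordinates: once the subspaces of vectors vanishing at
  \<open>s\<close> are stable, and also whether some vector is nonzero at \<open>s\<close>,
  elimination at \<open>s\<close> shows that the whole chain is stable.\<close>

lemma subspace_chain_stabilises:
  fixes V :: "nat \<Rightarrow> ('j \<Rightarrow> 'k :: field) set"
  assumes "finite S" "\<And>n. (\<lambda>_. 0) \<in> V n"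
    "\<And>n v w. v \<in> V n \<Longrightarrow> w \<in> V n \<Longrightarrow> (\<lambda>j. v j + w j) \<in> V n"
    "\<And>n v a. v \<in> V n \<Longrightarrow> (\<lambda>j. a * v j) \<in> V n"
    "\<And>n. V (Suc n) \<subseteq> V n"
    "\<And>n v j. v \<in> V n \<Longrightarrow> j \<notin> S \<Longrightarrow> v j = 0"
  shows "\<exists>n. \<forall>j\<ge>n. V j = V n"
  using assms
proof (induction S arbitrary: V rule: finite_induct)
  case empty
  have "V n = {\<lambda>_. 0}" for n using empty.prems(1,5) by (auto simp: fun_eq_iff)
  then show ?case by simp
next
  case (insert s S)
  have anti: "V j \<subseteq> V i" if "i \<le> j" for i j
    using that by (rule lift_Suc_antimono_le[where f = V, OF insert.prems(4)])
  define U where "U n = {v \<in> V n. v s = 0}" for n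
  have "\<exists>n. \<forall>j\<ge>n. U j = U n"
  proof (rule insert.IH)
    fix n v j assume "v \<in> U n" "j \<notin> S"
    then show "v j = 0" using insert.prems(5)[of v n j] by (cases "j = s") (auto simp: U_def)
  next
    fix n show "U (Suc n) \<subseteq> U n" unfolding U_def using insert.prems(4)[of n] by blast
  qed (use insert.prems(1,2,3) in \<open>auto simp: U_def\<close>)
  then obtain n1 where n1: "\<And>j. j \<ge> n1 \<Longrightarrow> U j = U n1" by blast
  \<comment> \<open>If all vectors vanish at \<open>s\<close> from some stage on, \<open>n2\<close>
    is such a stage and the premise fails; otherwise any \<open>n2\<close> works.\<close>
  obtain n2 where n2: "(\<exists>v\<in>V n2. v s \<noteq> 0) \<Longrightarrow> j \<ge> n2 \<Longrightarrow> \<exists>v\<in>V j. v s \<noteq> 0" for j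
    by blast
  define n where "n = max n1 n2"
  have "V n \<subseteq> V j" if j: "j \<ge> n" for j
  proof
    fix v assume v: "v \<in> V n"
    have UU: "U n = U j" using n1[of n] n1[of j] j by (simp add: n_def)
    show "v \<in> V j"
    proof (cases "v s = 0")
      case True
      then show ?thesis using v UU by (auto simp: U_def)
    next
      case False
      have "v \<in> V n2" using anti[of n2 n] v by (auto simp: n_def)
      then obtain w where w: "w \<in> V j" "w s \<noteq> 0" using n2[of j] False j by (auto simp: n_def)
      \<comment> \<open>Eliminating the coordinate \<open>s\<close> of \<open>v\<close> by
        \<open>w\<close> lands in \<open>U n\<close>, which equals \<open>U j\<close>.\<close>
      define u where "u = (\<lambda>i. v i + (- (v s / w s)) * w i)"
      have "w \<in> V n" using w anti[OF j] by auto
      then have "u \<in> V n" unfolding u_def using v insert.prems(2,3) by blast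
      moreover have "u s = 0" using w by (simp add: u_def)
      ultimately have "u \<in> U n" unfolding U_def by blast
      then have "u \<in> V j" unfolding UU unfolding U_def by blast
      then have "(\<lambda>i. u i + (v s / w s) * w i) \<in> V j" using w insert.prems(2,3) by blast
      then show ?thesis by (simp add: u_def)
    qed
  qed
  then have "\<forall>j\<ge>n. V j = V n" using anti by blast
  then show ?case by blast
qed

context matroid
begin

abbreviation R :: "('e, 'k :: comm_ring_1) mpoly set ring" where "R \<equiv> Q Quot J"

definition coset :: "('e, 'k :: comm_ring_1) mpoly \<Rightarrow> ('e, 'k) mpoly set" where
  "coset p = J +>\<^bsub>Q\<^esub> p"

lemma cring_R: "cring R"
  by (rule ideal.quotient_is_cring[OF ideal_J cring_mpoly_ring])

lemma coset_hom: "coset \<in> ring_hom Q R"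
  using ideal.rcos_ring_hom[OF ideal_J] by (simp add: coset_def[abs_def])

lemma carrier_R: "carrier R = coset ` carrier Q"
  by (auto simp: FactRing_def A_RCOSETS_def' coset_def)

lemma coset_closed: "p \<in> carrier Q \<Longrightarrow> coset p \<in> carrier R"
  by (simp add: carrier_R)

lemma coset_add: "p \<in> carrier Q \<Longrightarrow> q \<in> carrier Q \<Longrightarrow> coset (p + q) = coset p \<oplus>\<^bsub>R\<^esub> coset q"
  using ring_hom_add[OF coset_hom, of p q] by simp

lemma coset_mult: "p \<in> carrier Q \<Longrightarrow> q \<in> carrier Q \<Longrightarrow> coset (p * q) = coset p \<otimes>\<^bsub>R\<^esub> coset q"
  using ring_hom_mult[OF coset_hom, of p q] by simp

lemma coset_1: "coset 1 = \<one>\<^bsub>R\<^esub>"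
  using ring_hom_one[OF coset_hom] by simp

lemma coset_eq_0_iff: "p \<in> carrier Q \<Longrightarrow> coset p = \<zero>\<^bsub>R\<^esub> \<longleftrightarrow> (\<forall>F. phi p F = 0)"
  using ideal.rcos_const_imp_mem[OF ideal_J, of p] J_iff[of p]
    ring.a_rcos_zero[OF cring.axioms(1)[OF cring_mpoly_ring] ideal_J, of p]
  by (auto simp: FactRing_def coset_def)

lemma coset_0: "coset 0 = \<zero>\<^bsub>R\<^esub>"
  by (simp add: coset_eq_0_iff mpoly_carrier_0)

lemma coset_eqI:
  assumes pq: "p \<in> carrier Q" "q \<in> carrier Q" and "\<And>F. phi p F = phi q F"
  shows "coset p = coset q"
proof -
  interpret R: cring R by (rule cring_R)
  have d: "p - q \<in> carrier Q" using mpoly_carrier_add[OF pq(1) mpoly_carrier_uminus[OF pq(2)]] by simp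
  then have "coset (p - q) = \<zero>\<^bsub>R\<^esub>" using assms by (simp add: coset_eq_0_iff phi_diff)
  then have "coset (p - q + q) = coset q" using coset_add[OF d pq(2)] coset_closed[OF pq(2)] by simp
  then show ?thesis by simp
qed

text \<open>Constant polynomials act as scalars, so ideals become subspaces of coordinate vectors
  supported on the finite set of flats.\<close>

lemma artinian_R: "artinian (R :: ('e, 'k :: field) mpoly set ring)"
  unfolding artinian_def
proof (intro allI impI)
  fix I :: "nat \<Rightarrow> ('e, 'k) mpoly set set"
  assume I: "\<forall>n. ideal (I n) R \<and> I (Suc n) \<subseteq> I n"
  define V where "V n = {phi p | p. p \<in> carrier Q \<and> coset p \<in> I n}" for n
  \<comment> \<open>A coset is determined by its coordinates, so no information is lost in passing
    from \<open>I n\<close> to \<open>V n\<close>.\<close>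
  have I_iff: "coset p \<in> I n \<longleftrightarrow> phi p \<in> V n" if "p \<in> carrier Q" for p n
    using that coset_eqI[of p] unfolding V_def by (smt (verit) mem_Collect_eq)
  have "\<exists>n. \<forall>j\<ge>n. V j = V n"
  proof (rule subspace_chain_stabilises[OF finite_flats])
    fix n
    interpret I: ideal "I n" R using I by blast
    show "(\<lambda>_. 0) \<in> V n"
      using I.zero_closed unfolding V_def
      by (intro CollectI exI[of _ 0]) (simp add: fun_eq_iff coset_0 mpoly_carrier_0)
    show "(\<lambda>F. v F + w F) \<in> V n" if vw: "v \<in> V n" "w \<in> V n" for v w
    proof -
      obtain p q where "v = phi p" "w = phi q" "p \<in> carrier Q" "q \<in> carrier Q" "coset p \<in> I n" "coset q \<in> I n"
        using vw unfolding V_def by blast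
      then show ?thesis unfolding V_def using additive_subgroup.a_closed[OF I.is_additive_subgroup]
        by (intro CollectI exI[of _ "p + q"]) (auto simp: fun_eq_iff phi_add mpoly_carrier_add coset_add)
    qed
    show "(\<lambda>F. a * v F) \<in> V n" if v: "v \<in> V n" for v a
    proof -
      obtain p where "v = phi p" "p \<in> carrier Q" "coset p \<in> I n" using v unfolding V_def by blast
      moreover have "single 0 a \<in> carrier Q" by (rule mpoly_carrier_single) simp
      ultimately show ?thesis unfolding V_def using I.I_l_closed coset_closed
        by (intro CollectI exI[of _ "single 0 a * p"])
          (auto simp: fun_eq_iff phi_scale mpoly_carrier_mult coset_mult)
    qed
    show "V (Suc n) \<subseteq> V n" using I unfolding V_def by blast
    show "v F = 0" if "v \<in> V n" "F \<notin> Fl" for v F using that phi_not_flat by (auto simp: V_def)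
  qed
  then obtain n where n: "\<And>j. j \<ge> n \<Longrightarrow> V j = V n" by blast
  have "I j = I n" if "j \<ge> n" for j
  proof -
    have "x \<in> I j \<longleftrightarrow> x \<in> I n" if "x \<in> carrier R" for x
      using that I_iff n[OF \<open>j \<ge> n\<close>] by (auto simp: carrier_R)
    moreover have "I i \<subseteq> carrier R" for i
      using additive_subgroup.a_subset[OF ideal.axioms(1)] I by metis
    ultimately show ?thesis by (intro equalityI subsetI) (auto dest: subsetD)
  qed
  then show "\<exists>n. \<forall>j\<ge>n. I j = I n" by blast
qed

section \<open>The maximal ideal\<close>

definition mm :: "('e, 'k :: comm_ring_1) mpoly set set" where
  "mm = coset ` {p \<in> carrier Q. lookup p 0 = 0}"

text \<open>The constant term is the coordinate at \<open>cl {}\<close> and hence the same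
  throughout a coset.\<close>

lemma coset_mm_iff: "p \<in> carrier Q \<Longrightarrow> coset p \<in> mm \<longleftrightarrow> lookup p 0 = 0"
proof
  assume p: "p \<in> carrier Q" and "coset p \<in> mm"
  then obtain q where q: "q \<in> carrier Q" "lookup q 0 = 0" "coset p = coset q" by (auto simp: mm_def)
  have m: "- q \<in> carrier Q" using q by (simp add: mpoly_carrier_uminus)
  have "coset (p + - q) = coset (q + - q)" using p q m by (simp only: coset_add)
  then have "coset (p - q) = \<zero>\<^bsub>R\<^esub>" by (simp add: coset_0)
  then have "phi (p - q) (cl {}) = 0" using mpoly_carrier_add[OF p m] by (simp add: coset_eq_0_iff)
  then show "lookup p 0 = 0" using q by (simp add: phi_bottom lookup_minus)
qed (auto simp: mm_def)

lemma ideal_mm: "ideal (mm :: ('e, 'k :: comm_ring_1) mpoly set set) R"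
proof (rule cring.ideal_if_closed[OF cring_R])
  show "(mm :: ('e, 'k) mpoly set set) \<subseteq> carrier R" by (auto simp: mm_def carrier_R)
  show "\<zero>\<^bsub>R\<^esub> \<in> (mm :: ('e, 'k) mpoly set set)" using coset_mm_iff[OF mpoly_carrier_0] by (simp add: coset_0[symmetric])
  fix a x :: "('e, 'k) mpoly set" assume "a \<in> mm"
  then obtain p where p: "p \<in> carrier Q" "lookup p 0 = 0" "a = coset p" by (auto simp: mm_def)
  show "a \<oplus>\<^bsub>R\<^esub> b \<in> mm" if "b \<in> mm" for b
  proof -
    obtain q where q: "q \<in> carrier Q" "lookup q 0 = 0" "b = coset q" using \<open>b \<in> mm\<close> by (auto simp: mm_def)
    then show ?thesis
      using p coset_mm_iff[of "p + q"] by (simp add: coset_add[symmetric] mpoly_carrier_add lookup_add)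
  qed
  show "x \<otimes>\<^bsub>R\<^esub> a \<in> mm" if "x \<in> carrier R" for x
  proof -
    obtain q where q: "q \<in> carrier Q" "x = coset q" using \<open>x \<in> carrier R\<close> by (auto simp: carrier_R)
    then show ?thesis
      using p coset_mm_iff[of "q * p"] by (simp add: coset_mult[symmetric] mpoly_carrier_mult lookup_mult_zero)
  qed
qed

lemma maximal_mm: "maximalideal mm (R :: ('e, 'k :: field) mpoly set ring)"
proof (rule maximalidealI[OF ideal_mm])
  have "\<one>\<^bsub>R\<^esub> \<notin> mm" using coset_mm_iff[OF mpoly_carrier_1] by (simp add: coset_1)
  moreover have "\<one>\<^bsub>R\<^esub> \<in> carrier R" using coset_closed[OF mpoly_carrier_1] by (simp add: coset_1)
  ultimately show "carrier (R :: ('e, 'k) mpoly set ring) \<noteq> mm" by blast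
next
  fix I :: "('e, 'k) mpoly set set" assume I: "ideal I R" "mm \<subseteq> I" "I \<subseteq> carrier R"
  interpret I: ideal I R by fact
  show "I = mm \<or> I = carrier R"
  proof (cases "I = mm")
    case False
    then obtain p where p: "p \<in> carrier Q" "coset p \<in> I" "coset p \<notin> mm" using I by (auto simp: carrier_R)
    define a where "a = lookup p 0"
    have a: "a \<noteq> 0" using p(3) coset_mm_iff[OF p(1)] by (simp add: a_def)
    have const: "single 0 b \<in> carrier Q" for b :: 'k by (rule mpoly_carrier_single) simp
    \<comment> \<open>\<open>q\<close> has no constant term, so its class lies in \<open>mm\<close>
      and hence in \<open>I\<close>; adding it to \<open>p\<close> leaves a unit.\<close>
    define q where "q = single 0 a - p"
    have q: "q \<in> carrier Q"
      using mpoly_carrier_add[OF const mpoly_carrier_uminus[OF p(1)], of a] by (simp add: q_def)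
    have "coset q \<in> I" using coset_mm_iff[OF q] I(2) by (auto simp: q_def lookup_minus a_def)
    then have "coset (p + q) \<in> I" using additive_subgroup.a_closed[OF I.is_additive_subgroup p(2)] coset_add[OF p(1) q] by simp
    then have "coset (single 0 a) \<in> I" by (simp add: q_def)
    then have "coset (single 0 (1 / a)) \<otimes>\<^bsub>R\<^esub> coset (single 0 a) \<in> I"
      using coset_closed[OF const] by (rule I.I_l_closed)
    moreover have "coset (single 0 (1 / a)) \<otimes>\<^bsub>R\<^esub> coset (single 0 a) = \<one>\<^bsub>R\<^esub>"
      using a by (simp add: coset_mult[symmetric] const mult_single coset_1)
    ultimately show ?thesis using I.one_imp_carrier by simp
  qed simp
qed

text \<open>Variables square to 0 and so lie in every prime ideal. Hence every maximal ideal
  contains \<open>mm\<close>.\<close>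

lemma local_mm: "local_with (R :: ('e, 'k :: field) mpoly set ring) mm"
  unfolding local_with_def
proof (intro conjI allI impI maximal_mm)
  fix n :: "('e, 'k) mpoly set set" assume n: "maximalideal n R"
  interpret n: maximalideal n R by (rule n)
  interpret n: primeideal n R using cring.maximalideal_prime[OF cring_R n] .
  let ?X = "X_var :: 'e \<Rightarrow> ('e, 'k) mpoly"
  have X: "coset (?X e) \<in> n" if e: "e \<in> E" for e
  proof -
    have c: "?X e \<in> carrier Q" using e by (rule mpoly_carrier_X)
    have "?X e ^ 2 \<in> J" using e by (intro Lambda_in_J) (auto simp: Lambda_def)
    then have "coset (?X e * ?X e) = \<zero>\<^bsub>R\<^esub>"
      using phi_J[of "?X e ^ 2"] mpoly_carrier_mult[OF c c] by (simp add: coset_eq_0_iff power2_eq_square)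
    then have "coset (?X e) \<otimes>\<^bsub>R\<^esub> coset (?X e) \<in> n" using coset_mult[OF c c] n.zero_closed by simp
    then show ?thesis using n.I_prime[OF coset_closed[OF c] coset_closed[OF c]] by simp
  qed
  have "p \<in> carrier Q \<and> coset p \<in> n" if "p \<in> carrier Q" "lookup p 0 = 0" for p
    using that
  proof (induction p rule: augmentation_induct)
    case zero
    then show ?case using n.zero_closed by (simp add: coset_0 mpoly_carrier_0)
  next
    case (var e q)
    then show ?case using n.I_r_closed[OF X coset_closed]
      by (simp add: coset_mult mpoly_carrier_mult mpoly_carrier_X)
  next
    case (add p q)
    then show ?case using additive_subgroup.a_closed[OF n.is_additive_subgroup] by (simp add: coset_add mpoly_carrier_add)
  qed
  then have sub: "mm \<subseteq> n" by (auto simp: mm_def)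
  interpret m: maximalideal "mm :: ('e, 'k) mpoly set set" R by (rule maximal_mm)
  have "n = mm \<or> n = carrier R" using n.is_ideal sub n.a_subset by (rule m.I_maximal)
  then show "n = mm" using n.I_notcarr by simp
qed

text \<open>A polynomial without constant term is a sum of multiples of variables, so being killed
  by \<open>mm\<close> is being killed by the variables.\<close>

lemma coset_socle_iff:
  fixes p :: "('e, 'k :: comm_ring_1) mpoly"
  assumes p: "p \<in> carrier Q"
  shows "coset p \<in> socle R mm \<longleftrightarrow> (\<forall>e\<in>E. \<forall>G. act e (phi p) G = 0)"
proof
  assume s: "coset p \<in> socle R mm"
  show "\<forall>e\<in>E. \<forall>G. act e (phi p) G = 0"
  proof (intro ballI allI)
    fix e G assume e: "e \<in> E"
    let ?X = "X_var e :: ('e, 'k) mpoly"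
    have c: "?X \<in> carrier Q" using e by (rule mpoly_carrier_X)
    have "lookup (single e (1::nat)) e \<noteq> lookup 0 e" by simp
    then have "single e (1::nat) \<noteq> 0" by metis
    then have "lookup ?X 0 = 0" unfolding X_var_def by (simp add: lookup_single when_def)
    then have "coset (?X) \<in> mm" using coset_mm_iff[OF c] by simp
    then have "coset (?X) \<otimes>\<^bsub>R\<^esub> coset p = \<zero>\<^bsub>R\<^esub>" using s by (simp add: socle_def)
    then have "phi (?X * p) G = 0"
      using coset_eq_0_iff[OF mpoly_carrier_mult[OF c p]] coset_mult[OF c p] by simp
    then show "act e (phi p) G = 0" using phi_X_var[OF e, of p] by simp
  qed
next
  assume a: "\<forall>e\<in>E. \<forall>G. act e (phi p) G = 0"
  have "\<forall>G. phi (q * p) G = 0" if "q \<in> carrier Q" "lookup q 0 = 0" for q :: "('e, 'k) mpoly"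
    using that
  proof (induction q rule: augmentation_induct)
    case (var e q)
    have "phi (q * (X_var e * p)) G = 0" for G
      by (rule phi_mult_eq_0[OF var(2)]) (simp add: phi_X_var[OF var(1)] a var(1))
    then show ?case by (simp add: algebra_simps)
  qed (auto simp: algebra_simps phi_add)
  then have "coset q \<otimes>\<^bsub>R\<^esub> coset p = \<zero>\<^bsub>R\<^esub>" if "q \<in> carrier Q" "lookup q 0 = 0" for q
    using that coset_eq_0_iff[OF mpoly_carrier_mult[OF _ p]] coset_mult[OF _ p] by metis
  then show "coset p \<in> socle R mm" using coset_closed[OF p] by (auto simp: socle_def mm_def)
qed

text \<open>On the socle a ring element acts through its constant term, so generation by one element
  means proportionality of coordinate vectors. As \<open>y\<^sub>E\<close> always lies in the socle,
  it must be the generator up to a scalar.\<close>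

theorem gorenstein_iff_trivial_socle:
  "artinian_gorenstein (R :: ('e, 'k :: field) mpoly set ring) \<longleftrightarrow> trivial_socle TYPE('k)"
proof -
  interpret R: cring "R :: ('e, 'k) mpoly set ring" by (rule cring_R)
  let ?R = "R :: ('e, 'k) mpoly set ring"
  define t :: "('e, 'k) mpoly" where "t = psi (\<lambda>F. if F = E then 1 else 0)"
  have topc: "t \<in> carrier Q" by (simp add: t_def psi_carrier)
  have phi_top: "phi t F = (if F = E then 1 else 0)" for F
  proof (cases "F \<in> Fl")
    case True
    then show ?thesis unfolding t_def by (rule phi_psi)
  next
    case False
    then show ?thesis using phi_not_flat[OF False] ground_flat by auto
  qed
  \<comment> \<open>No element of \<open>E\<close> lies outside the flat \<open>E\<close>, so every
    variable kills \<open>y\<^sub>E\<close>.\<close>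
  have top_socle: "coset t \<in> socle R mm"
    unfolding coset_socle_iff[OF topc] act_def by (auto simp: phi_top intro!: sum.neutral)
  have top_nz: "coset t \<noteq> \<zero>\<^bsub>R\<^esub>" using coset_eq_0_iff[OF topc] phi_top by (auto intro!: exI[of _ E])
  have const: "single 0 b \<in> carrier Q" for b :: 'k by (rule mpoly_carrier_single) simp
  have mult_socle: "phi (q * p) F = lookup q 0 * phi p F"
    if p: "p \<in> carrier Q" "coset p \<in> socle R mm" and q: "q \<in> carrier Q"
    for p q :: "('e, 'k) mpoly" and F
  proof -
    define q0 where "q0 = q - single 0 (lookup q 0)"
    have q0: "q0 \<in> carrier Q"
      using mpoly_carrier_add[OF q mpoly_carrier_uminus[OF const[of "lookup q 0"]]] by (simp add: q0_def)
    have "coset q0 \<in> mm" using coset_mm_iff[OF q0] by (simp add: q0_def lookup_minus)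
    then have "coset q0 \<otimes>\<^bsub>R\<^esub> coset p = \<zero>\<^bsub>R\<^esub>" using p by (simp add: socle_def)
    then have "phi (q0 * p) F = 0"
      using coset_eq_0_iff[OF mpoly_carrier_mult[OF q0 p(1)]] coset_mult[OF q0 p(1)] by simp
    moreover have "q * p = q0 * p + single 0 (lookup q 0) * p" by (simp add: q0_def algebra_simps)
    ultimately show ?thesis by (simp add: phi_add phi_scale)
  qed
  show ?thesis
  proof
    assume "artinian_gorenstein ?R"
    then obtain M s where M: "local_with ?R M" "s \<in> socle R M"
      "socle ?R M = {a \<otimes>\<^bsub>R\<^esub> s | a. a \<in> carrier R}"
      unfolding artinian_gorenstein_def by blast
    have "M = mm" using M(1) maximal_mm unfolding local_with_def by blast
    with M obtain p where p: "p \<in> carrier Q" "s = coset p" "coset p \<in> socle R mm"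
      and span: "socle ?R mm = {a \<otimes>\<^bsub>R\<^esub> coset p | a. a \<in> carrier R}"
      by (auto simp: socle_def carrier_R)
    have mult: "\<exists>\<mu>. \<forall>F. phi q F = \<mu> * phi p F" if q: "q \<in> carrier Q" "coset q \<in> socle R mm" for q
    proof -
      obtain a where a: "a \<in> carrier Q" "coset q = coset a \<otimes>\<^bsub>R\<^esub> coset p"
        using q span by (auto simp: carrier_R)
      have "coset (q - a * p) = \<zero>\<^bsub>R\<^esub>"
      proof -
        have ap: "a * p \<in> carrier Q" using a p by (simp add: mpoly_carrier_mult)
        have "coset (q + - (a * p)) = coset (a * p + - (a * p))"
          using q a p ap mpoly_carrier_uminus[OF ap] by (simp only: coset_add coset_mult)
        then show ?thesis by (simp add: coset_0)
      qed
      moreover have "q - a * p \<in> carrier Q"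
        using mpoly_carrier_add[OF q(1) mpoly_carrier_uminus[OF mpoly_carrier_mult[OF a(1) p(1)]]] by simp
      ultimately have "phi q F = phi (a * p) F" for F by (simp add: coset_eq_0_iff phi_diff)
      then show ?thesis using mult_socle[OF p(1,3) a(1)] by auto
    qed
    \<comment> \<open>\<open>y\<^sub>E\<close> is a nonzero multiple of the generator, whose
      coordinates therefore vanish off \<open>E\<close>; then so do those of every socle
      element.\<close>
    obtain l where l: "\<And>F. phi t F = l * phi p F" using mult[OF topc top_socle] by blast
    show "trivial_socle TYPE('k)"
      unfolding trivial_socle_def
    proof (intro allI impI ballI)
      fix c :: "'e set \<Rightarrow> 'k" and F
      assume c: "\<forall>e\<in>E. \<forall>G. act e c G = 0" and F: "F \<in> Fl" "F \<noteq> E"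
      have "act e (phi (psi c)) G = act e c G" for e G
        unfolding act_def by (rule sum.cong) (auto simp: phi_psi)
      then have "coset (psi c) \<in> socle R mm" using c coset_socle_iff[OF psi_carrier] by metis
      then obtain \<mu> where \<mu>: "\<And>F. phi (psi c) F = \<mu> * phi p F" using mult[OF psi_carrier] by blast
      have "l \<noteq> 0" using l[of E] phi_top[of E] by auto
      moreover have "l * phi p F = 0" using l[of F] phi_top[of F] F by simp
      ultimately show "c F = 0" using \<mu>[of F] phi_psi[OF F(1), of c] by simp
    qed
  next
    assume triv: "trivial_socle TYPE('k)"
    have "socle ?R mm = {a \<otimes>\<^bsub>R\<^esub> coset t | a. a \<in> carrier R}"
    proof (intro equalityI subsetI)
      fix x assume x: "x \<in> socle ?R mm"
      then obtain p where p: "p \<in> carrier Q" "x = coset p" by (auto simp: socle_def carrier_R)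
      have "phi p F = 0" if "F \<noteq> E" for F
        using triv x p coset_socle_iff[OF p(1)] that phi_not_flat[of F p]
        unfolding trivial_socle_def by (cases "F \<in> Fl") blast+
      \<comment> \<open>With \<open>E\<close> as its only possibly nonzero coordinate, the class of
        \<open>p\<close> is the scalar \<open>phi p E\<close> times
        \<open>y\<^sub>E\<close>.\<close>
      then have "phi p F = phi (single 0 (phi p E) * t) F" for F by (simp add: phi_scale phi_top)
      then have "coset p = coset (single 0 (phi p E) * t)"
        using p topc const by (intro coset_eqI mpoly_carrier_mult)
      then show "x \<in> {a \<otimes>\<^bsub>R\<^esub> coset t | a. a \<in> carrier R}"
        using p coset_mult[OF const topc] coset_closed[OF const] by blast
    next
      fix x assume "x \<in> {a \<otimes>\<^bsub>R\<^esub> coset t | a. a \<in> carrier R}"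
      then obtain a where a: "a \<in> carrier R" "x = a \<otimes>\<^bsub>R\<^esub> coset t" by blast
      have "b \<otimes>\<^bsub>R\<^esub> x = \<zero>\<^bsub>R\<^esub>" if b: "b \<in> mm" for b
      proof -
        have bc: "b \<in> carrier R" using b ideal.Icarr[OF ideal_mm] by blast
        have "b \<otimes>\<^bsub>R\<^esub> x = a \<otimes>\<^bsub>R\<^esub> (b \<otimes>\<^bsub>R\<^esub> coset t)"
          using a bc coset_closed[OF topc] by (simp add: R.m_lcomm)
        also have "b \<otimes>\<^bsub>R\<^esub> coset t = \<zero>\<^bsub>R\<^esub>" using top_socle b by (simp add: socle_def)
        finally show ?thesis using a by simp
      qed
      then show "x \<in> socle ?R mm" using a coset_closed[OF topc] by (simp add: socle_def)
    qed
    then show "artinian_gorenstein ?R"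
      unfolding artinian_gorenstein_def
      using cring_R artinian_R local_mm top_socle top_nz by blast
  qed
qed

end

theorem theorem5p7:
  fixes E :: "'e set" and \<F> :: "'e set set"
  assumes "matroid E \<F>"
  shows "artinian_gorenstein
           (mpoly_ring E Quot (matroid_ideal E \<F> :: ('e, 'k :: field_char_0) mpoly set))
         \<longleftrightarrow> modular_geometric_lattice (flat_lattice E \<F>) (rank \<F>)"
  using matroid.gorenstein_iff_trivial_socle[OF assms] matroid.modular_geometric_iff_trivial_socle[OF assms]
  by metis

end
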